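(* Let $C_n$ be the cycle graph on $[n]$. The v-number of the binomial edge ideal $J_{C_n}$ satisfies the following: (i) if $n\equiv0\pmod 3$, then $\mathrm{v}(J_{C_n})=\frac{2n}{3}$; (ii) if $n\equiv1$ or $2\pmod3$, then $\mathrm{v}(J_{C_n})$ is either $\left\lceil\frac{2n}{3}\right\rceil$ or $\left\lceil\frac{2n}{3}\right\rceil-1$.
   Context: $C_n$ is the graph with vertex set $[n]=\{1,\dots,n\}$ and edges $\{i,i+1\}$ for $i\in[n]$, with the convention $n+1=1$. The binomial edge ideal of a simple graph $G$ on $[n]$ is $J_G=(x_iy_j-x_jy_i : \{i,j\}\in E(G),\ i<j)\subset R=\mathbb{C}[x_1,\dots,x_n,y_1,\dots,y_n]$, where $R$ has the standard grading. For a homogeneous ideal $I\subset R$, the v-number is $\mathrm{v}(I)=\min\{d\ge0 : \exists f\in R \text{ homogeneous of degree } d \text{ and } \mathfrak{p}\in\mathrm{Ass}(I) \text{ with } (I:f)=\mathfrak{p}\}$.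
   Formalization: The formal theorem assumes n ≥ 4: for n = 3 the claim fails, since C_3 = K_3 has a prime binomial edge ideal, so its v-number is 0 rather than 2n/3 = 2; for n < 3, C_n is not a cycle. *)

theory Defs
  imports Complex_Main "HOL-Library.Poly_Mapping" "HOL-Algebra.Ideal"
begin

datatype var = X nat | Y nat

type_synonym mpoly = "(var \<Rightarrow>\<^sub>0 nat) \<Rightarrow>\<^sub>0 complex"

definition indet :: "var \<Rightarrow> mpoly" where
  "indet v = Poly_Mapping.single (Poly_Mapping.single v 1) 1"

definition vars :: "nat \<Rightarrow> var set" where
  "vars n = X ` {1..n} \<union> Y ` {1..n}"

definition poly_ring :: "nat \<Rightarrow> mpoly ring" where
  "poly_ring n =
    \<lparr>carrier = {p. \<forall>m\<in>Poly_Mapping.keys p. Poly_Mapping.keys m \<subseteq> vars n},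
     mult = (*), one = 1, zero = 0, add = (+)\<rparr>"

definition mon_degree :: "(var \<Rightarrow>\<^sub>0 nat) \<Rightarrow> nat" where
  "mon_degree m = (\<Sum>v\<in>Poly_Mapping.keys m. Poly_Mapping.lookup m v)"

text \<open>As usual, the zero polynomial is homogeneous of every degree.\<close>

definition homogeneous :: "nat \<Rightarrow> mpoly \<Rightarrow> bool" where
  "homogeneous d f \<longleftrightarrow> (\<forall>m\<in>Poly_Mapping.keys f. mon_degree m = d)"

definition colon :: "('a, 'b) ring_scheme \<Rightarrow> 'a set \<Rightarrow> 'a \<Rightarrow> 'a set" where
  "colon R I f = {g \<in> carrier R. g \<otimes>\<^bsub>R\<^esub> f \<in> I}"

text \<open>
  The associated primes of \<open>I\<close> are those of the module \<open>R/I\<close>: the prime ideals that are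
  annihilators of residue classes \<open>f + I\<close>, and such an annihilator is \<open>(I : f)\<close>.
\<close>

definition Ass :: "('a, 'b) ring_scheme \<Rightarrow> 'a set \<Rightarrow> 'a set set" where
  "Ass R I = {P. primeideal P R \<and> (\<exists>f\<in>carrier R. P = colon R I f)}"

definition v_number :: "nat \<Rightarrow> mpoly set \<Rightarrow> nat" where
  "v_number n I =
    (LEAST d. \<exists>f\<in>carrier (poly_ring n). homogeneous d f \<and>
       (\<exists>P\<in>Ass (poly_ring n) I. colon (poly_ring n) I f = P))"

definition binomial_edge_ideal :: "nat \<Rightarrow> nat set set \<Rightarrow> mpoly set" where
  "binomial_edge_ideal n E =
    Idl\<^bsub>poly_ring n\<^esub>
      {indet (X i) * indet (Y j) - indet (X j) * indet (Y i) | i j. {i, j} \<in> E \<and> i < j}"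

definition cycle_edges :: "nat \<Rightarrow> nat set set" where
  "cycle_edges n = {{i, if i = n then 1 else i + 1} | i. i \<in> {1..n}}"

end

theory Submission
  imports Defs
begin

text \<open>
  For a set \<open>T\<close> of vertices let \<open>P\<^sub>T\<close> be the kernel of the substitution that kills \<open>x\<^sub>i, y\<^sub>i\<close> for
  \<open>i \<in> T\<close> and makes the vectors \<open>(x\<^sub>i, y\<^sub>i)\<close> parallel along each component of \<open>G - T\<close>. A monomial may
  be changed modulo \<open>J\<^sub>G\<close> by moving exponents within the components of its support, so \<open>J\<^sub>G\<close> is the
  intersection of the primes \<open>P\<^sub>T\<close>, and \<open>(J : f)\<close> is the intersection of those \<open>P\<^sub>T\<close> that do not
  contain \<open>f\<close>. If it is prime, it equals one of them, say \<open>P\<^sub>S\<close>.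

  Lower bound: let \<open>a\<close> be a multidegree in which \<open>f\<close> does not vanish modulo \<open>P\<^sub>S\<close>. As \<open>P\<^sub>S\<close> multiplies
  \<open>f\<close> into \<open>J\<close>, for the cycle \<open>a\<close> is positive outside \<open>S\<close> if \<open>S \<noteq> {}\<close>, has at most two zeros if
  \<open>S = {}\<close>, and for \<open>|S| \<ge> 3\<close> is at least 2 on an arc consisting of a single vertex. So the degree
  \<open>d\<close> is at least \<open>n - 2\<close>, or it is at least both \<open>n - |S|\<close> and \<open>2|S|\<close>, whence \<open>3d \<ge> 2n\<close>.

  Upper bound: for pairwise non-adjacent \<open>S\<close> with \<open>|S| \<ge> 2\<close>, the product of the minors on the pairs
  \<open>s - 1, s + 1\<close> for \<open>s \<in> S\<close> and of the \<open>x\<^sub>i\<close> for \<open>i\<close> at distance at least 2 from \<open>S\<close> has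
  colon ideal \<open>P\<^sub>S\<close>; take every third vertex. For \<open>n = 4\<close> the product \<open>x\<^sub>3 x\<^sub>4\<close> has the smaller degree.
\<close>

abbreviation (input) "lookup \<equiv> Poly_Mapping.lookup"
abbreviation (input) "keys \<equiv> Poly_Mapping.keys"
abbreviation (input) "single \<equiv> Poly_Mapping.single"

type_synonym mono = "var \<Rightarrow>\<^sub>0 nat"

subsection \<open>Additive extensions\<close>

definition additive_ext :: "('k \<Rightarrow> 'c::zero \<Rightarrow> 'a::comm_monoid_add) \<Rightarrow> ('k \<Rightarrow>\<^sub>0 'c) \<Rightarrow> 'a" where
  "additive_ext F p = (\<Sum>k\<in>keys p. F k (lookup p k))"

lemma additive_ext_zero [simp]: "additive_ext F 0 = 0"
  by (simp add: additive_ext_def)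

lemma additive_ext_single: "F k 0 = 0 \<Longrightarrow> additive_ext F (single k c) = F k c"
  by (simp add: additive_ext_def)

lemma additive_ext_add:
  assumes "\<And>k. F k 0 = 0" "\<And>k c d. F k (c + d) = F k c + F k d"
  shows "additive_ext F (p + q) = additive_ext F p + additive_ext F q"
  unfolding additive_ext_def by (rule setsum_keys_plus_distrib) (simp_all add: assms)

lemma additive_ext_cong:
  "(\<And>k. k \<in> keys p \<Longrightarrow> F k (lookup p k) = G k (lookup p k)) \<Longrightarrow> additive_ext F p = additive_ext G p"
  by (simp add: additive_ext_def)

lemma additive_ext_hom:
  assumes "g 0 = 0" "\<And>x y. g (x + y) = g x + g y"
  shows "g (additive_ext F p) = additive_ext (\<lambda>k c. g (F k c)) p"
  unfolding additive_ext_def using sum_comp_morphism[of g "\<lambda>k. F k (lookup p k)" "keys p", OF assms]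
  by (simp add: o_def)

lemma lookup_additive_ext: "lookup (additive_ext F p) x = (\<Sum>k\<in>keys p. lookup (F k (lookup p k)) x)"
  by (simp add: additive_ext_def lookup_sum)

lemma additive_ext_self: "additive_ext single p = p"
  by (rule poly_mapping_eqI) (simp add: lookup_additive_ext lookup_single when_def in_keys_iff)

lemma additive_eqI:
  fixes g g' :: "('k \<Rightarrow>\<^sub>0 'c::comm_monoid_add) \<Rightarrow> 'a::comm_monoid_add"
  assumes "g 0 = 0" "\<And>x y. g (x + y) = g x + g y" "g' 0 = 0" "\<And>x y. g' (x + y) = g' x + g' y"
    and "\<And>k c. g (single k c) = g' (single k c)"
  shows "g p = g' p"
  using additive_ext_hom[of g, OF assms(1,2), of single p]
    additive_ext_hom[of g', OF assms(3,4), of single p]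
  by (simp add: additive_ext_self assms(5))

lemma single_one_inject [simp]: "single k (1::'b::zero_neq_one) = single k' 1 \<longleftrightarrow> k = k'"
  by (metis keys_single the_elem_eq zero_neq_one)

lemma keys_add_eq_Un: "keys (m + m') = keys m \<union> keys (m' :: 'a \<Rightarrow>\<^sub>0 nat)"
  by (auto simp: in_keys_iff lookup_add)

lemma obtain_single_summand:
  fixes m :: "'a \<Rightarrow>\<^sub>0 nat"
  assumes "lookup m v > 0"
  obtains k where "m = k + single v 1"
proof
  show "m = (m - single v 1) + single v 1"
    by (rule poly_mapping_eqI)
      (use assms in \<open>auto simp: lookup_add lookup_minus lookup_single when_def\<close>)
qed

subsection \<open>Mapping monomials to monomials\<close>

definition monomial_map :: "('a \<Rightarrow> bool) \<Rightarrow> ('a \<Rightarrow> 'b) \<Rightarrow> ('a \<Rightarrow>\<^sub>0 'c::comm_monoid_add) \<Rightarrow> ('b \<Rightarrow>\<^sub>0 'c)" where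
  "monomial_map A \<theta> = additive_ext (\<lambda>m c. if A m then single (\<theta> m) c else 0)"

lemma monomial_map_zero [simp]: "monomial_map A \<theta> 0 = 0"
  by (simp add: monomial_map_def)

lemma monomial_map_add: "monomial_map A \<theta> (f + g) = monomial_map A \<theta> f + monomial_map A \<theta> g"
  unfolding monomial_map_def by (rule additive_ext_add) (simp_all add: single_add)

lemma monomial_map_diff:
  fixes f g :: "'a \<Rightarrow>\<^sub>0 'c::ab_group_add"
  shows "monomial_map A \<theta> (f - g) = monomial_map A \<theta> f - monomial_map A \<theta> g"
  using monomial_map_add[of A \<theta> "f - g" g] by simp

lemma monomial_map_single: "monomial_map A \<theta> (single m c) = (if A m then single (\<theta> m) c else 0)"
  by (simp add: monomial_map_def additive_ext_single)

lemma monomial_map_cong: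
  assumes "\<And>m. m \<in> keys f \<Longrightarrow> A m = B m" "\<And>m. m \<in> keys f \<Longrightarrow> B m \<Longrightarrow> \<theta> m = \<eta> m"
  shows "monomial_map A \<theta> f = monomial_map B \<eta> f"
  unfolding monomial_map_def by (rule additive_ext_cong) (simp add: assms)

lemma monomial_map_comp:
  assumes "\<And>m. m \<in> keys f \<Longrightarrow> C m \<longleftrightarrow> A m \<and> B (\<theta> m)"
    and "\<And>m. m \<in> keys f \<Longrightarrow> C m \<Longrightarrow> \<eta> (\<theta> m) = \<zeta> m"
  shows "monomial_map B \<eta> (monomial_map A \<theta> f) = monomial_map C \<zeta> f"
proof -
  have "monomial_map B \<eta> (monomial_map A \<theta> f) =
      additive_ext (\<lambda>m c. monomial_map B \<eta> (if A m then single (\<theta> m) c else 0)) f"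
    unfolding monomial_map_def[of A] by (rule additive_ext_hom) (simp_all add: monomial_map_add)
  also have "\<dots> = monomial_map C \<zeta> f"
    unfolding monomial_map_def[of C] using assms
    by (intro additive_ext_cong) (auto simp: monomial_map_single)
  finally show ?thesis .
qed

lemma monomial_map_mult:
  fixes f g :: "'a::monoid_add \<Rightarrow>\<^sub>0 'c::semiring_0" and \<theta> :: "'a \<Rightarrow> 'b::monoid_add"
  assumes "\<And>m m'. A (m + m') \<longleftrightarrow> A m \<and> A m'" "\<And>m m'. \<theta> (m + m') = \<theta> m + \<theta> m'"
  shows "monomial_map A \<theta> (f * g) = monomial_map A \<theta> f * monomial_map A \<theta> g"
proof -
  have single: "monomial_map A \<theta> (single m c * g) = monomial_map A \<theta> (single m c) * monomial_map A \<theta> g"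
    for m c
    by (rule additive_eqI)
      (simp_all add: monomial_map_add monomial_map_single distrib_left mult_single assms)
  show ?thesis
    by (rule additive_eqI[where p = f]) (simp_all add: monomial_map_add distrib_right single)
qed

lemma keys_monomial_map_id: "keys (monomial_map A id f) = {m \<in> keys f. A m}"
proof -
  have "lookup (monomial_map A id f) k =
      (\<Sum>m\<in>keys f. if k = m then if A k then lookup f k else 0 else 0)" for k
    unfolding monomial_map_def lookup_additive_ext
    by (intro sum.cong) (auto simp: lookup_single when_def)
  then show ?thesis
    by (auto simp: in_keys_iff split: if_splits)
qed

lemma sum_monomial_map_fibres: "f = (\<Sum>a\<in>\<theta> ` keys f. monomial_map (\<lambda>m. \<theta> m = a) id f)"
proof -
  have "f = additive_ext single f"
    by (simp only: additive_ext_self)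
  also have "\<dots> = (\<Sum>a\<in>\<theta> ` keys f. \<Sum>m\<in>{m \<in> keys f. \<theta> m = a}. single m (lookup f m))"
    unfolding additive_ext_def by (rule sum.image_gen) simp
  also have "\<dots> = (\<Sum>a\<in>\<theta> ` keys f. monomial_map (\<lambda>m. \<theta> m = a) id f)"
    by (simp add: monomial_map_def additive_ext_def sum.inter_filter cong: if_cong)
  finally show ?thesis .
qed

subsection \<open>The parametrisations\<close>

definition multidegree :: "mono \<Rightarrow> nat \<Rightarrow> nat" where
  "multidegree m i = lookup m (X i) + lookup m (Y i)"

definition avoids :: "nat set \<Rightarrow> mono \<Rightarrow> bool" where
  "avoids T m \<longleftrightarrow> (\<forall>i\<in>T. multidegree m i = 0)"

definition param_mono :: "(nat \<Rightarrow> nat) \<Rightarrow> mono \<Rightarrow> mono" where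
  "param_mono h = additive_ext (\<lambda>v c. case v of
     X i \<Rightarrow> single (X i) c
   | Y i \<Rightarrow> single (X i) c + single (Y (h i)) c)"

text \<open>
  The substitution \<open>x\<^sub>i \<mapsto> x\<^sub>i\<close>, \<open>y\<^sub>i \<mapsto> x\<^sub>i y\<^bsub>h i\<^esub>\<close> for \<open>i \<notin> T\<close>, and \<open>x\<^sub>i, y\<^sub>i \<mapsto> 0\<close> for \<open>i \<in> T\<close>.
\<close>

definition param :: "nat set \<Rightarrow> (nat \<Rightarrow> nat) \<Rightarrow> mpoly \<Rightarrow> mpoly" where
  "param T h = monomial_map (avoids T) (param_mono h)"

lemma X_in_vars [simp]: "X i \<in> vars n \<longleftrightarrow> i \<in> {1..n}"
  and Y_in_vars [simp]: "Y i \<in> vars n \<longleftrightarrow> i \<in> {1..n}"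
  by (auto simp: vars_def)

lemma multidegree_zero [simp]: "multidegree 0 i = 0"
  by (simp add: multidegree_def)

lemma multidegree_add: "multidegree (m + m') i = multidegree m i + multidegree m' i"
  by (simp add: multidegree_def lookup_add)

lemma multidegree_single_X [simp]: "multidegree (single (X i) c) j = (if i = j then c else 0)"
  and multidegree_single_Y [simp]: "multidegree (single (Y i) c) j = (if i = j then c else 0)"
  by (auto simp: multidegree_def lookup_single when_def)

lemma avoids_empty [simp]: "avoids {} = (\<lambda>_. True)"
  by (simp add: avoids_def fun_eq_iff)

lemma avoids_add: "avoids T (m + m') \<longleftrightarrow> avoids T m \<and> avoids T m'"
  by (auto simp: avoids_def multidegree_add)

lemma param_mono_zero [simp]: "param_mono h 0 = 0"
  by (simp add: param_mono_def)

lemma param_mono_add: "param_mono h (m + m') = param_mono h m + param_mono h m'"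
  unfolding param_mono_def
  by (rule additive_ext_add) (simp_all add: single_add ac_simps split: var.splits)

lemma param_mono_single_X: "param_mono h (single (X i) c) = single (X i) c"
  and param_mono_single_Y: "param_mono h (single (Y i) c) = single (X i) c + single (Y (h i)) c"
  by (simp_all add: param_mono_def additive_ext_single)

lemma param_mono_cong:
  assumes "\<And>i. multidegree m i > 0 \<Longrightarrow> h i = h' i"
  shows "param_mono h m = param_mono h' m"
  unfolding param_mono_def using assms
  by (intro additive_ext_cong) (auto simp: multidegree_def in_keys_iff split: var.splits)

lemma lookup_param_mono_X: "lookup (param_mono h m) (X i) = multidegree m i"
proof (rule additive_eqI[where p = m])
  fix v c
  show "lookup (param_mono h (single v c)) (X i) = multidegree (single v c) i"
    by (cases v)
      (simp_all add: param_mono_single_X param_mono_single_Y lookup_add lookup_single when_def)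
qed (simp_all add: param_mono_add multidegree_add lookup_add)

lemma lookup_param_mono_Y:
  assumes "keys m \<subseteq> vars n"
  shows "lookup (param_mono h m) (Y l) = (\<Sum>i | i \<in> {1..n} \<and> h i = l. lookup m (Y i))"
proof -
  have "lookup (param_mono h m) (Y l) =
      (\<Sum>v\<in>keys m. case v of X i \<Rightarrow> 0 | Y i \<Rightarrow> if h i = l then lookup m (Y i) else 0)"
    unfolding param_mono_def lookup_additive_ext
    by (intro sum.cong) (auto simp: lookup_add lookup_single when_def split: var.split)
  also have "\<dots> = (\<Sum>v\<in>Y ` {i. i \<in> {1..n} \<and> h i = l}. lookup m v)"
  proof (rule sum.mono_neutral_cong)
    fix v assume "v \<in> keys m - Y ` {i. i \<in> {1..n} \<and> h i = l}"
    then show "(case v of X i \<Rightarrow> 0 | Y i \<Rightarrow> if h i = l then lookup m (Y i) else 0) = 0"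
      using assms by (cases v) auto
  qed (auto simp: in_keys_iff)
  finally show ?thesis
    by (simp add: sum.reindex inj_on_def)
qed

definition relabel :: "(nat \<Rightarrow> nat) \<Rightarrow> mono \<Rightarrow> mono" where
  "relabel r = additive_ext (\<lambda>v c. case v of X i \<Rightarrow> single (X i) c | Y l \<Rightarrow> single (Y (r l)) c)"

lemma relabel_param_mono: "relabel r (param_mono h m) = param_mono (r \<circ> h) m"
proof -
  have add: "relabel r (p + q) = relabel r p + relabel r q" for p q
    unfolding relabel_def by (rule additive_ext_add) (simp_all add: single_add split: var.splits)
  have zero: "relabel r 0 = 0"
    by (simp add: relabel_def)
  have single: "relabel r (single (X i) c) = single (X i) c"
    "relabel r (single (Y i) c) = single (Y (r i)) c" for i c
    by (simp_all add: relabel_def additive_ext_single)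
  show ?thesis
  proof (rule additive_eqI[where p = m])
    fix v c
    show "relabel r (param_mono h (single v c)) = param_mono (r \<circ> h) (single v c)"
      by (cases v) (simp_all add: param_mono_single_X param_mono_single_Y add single)
  qed (simp_all add: param_mono_add add zero)
qed

lemma param_zero [simp]: "param T h 0 = 0"
  and param_add: "param T h (f + g) = param T h f + param T h g"
  and param_diff: "param T h (f - g) = param T h f - param T h g"
  and param_single: "param T h (single m c) = (if avoids T m then single (param_mono h m) c else 0)"
  unfolding param_def
  by (rule monomial_map_zero monomial_map_add monomial_map_diff monomial_map_single)+

lemma param_mult: "param T h (f * g) = param T h f * param T h g"
  unfolding param_def by (rule monomial_map_mult) (simp_all add: avoids_add param_mono_add)

lemma param_one [simp]: "param T h 1 = 1"
  using param_single[of T h 0 1] by (simp add: avoids_def)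

lemma param_prod: "param T h (prod F A) = (\<Prod>a\<in>A. param T h (F a))"
  by (induction A rule: infinite_finite_induct) (simp_all add: param_mult)

lemma param_indet_X: "param T h (indet (X i)) = (if i \<in> T then 0 else indet (X i))"
  and param_indet_Y: "param T h (indet (Y i)) = (if i \<in> T then 0 else indet (X i) * indet (Y (h i)))"
  by (auto simp: indet_def param_single avoids_def param_mono_single_X[unfolded One_nat_def]
    param_mono_single_Y[unfolded One_nat_def] mult_single)

lemma param_eq_0_coarsen:
  assumes "param T h f = 0"
    and keys: "\<And>m. m \<in> keys f \<Longrightarrow> avoids T' m \<Longrightarrow> avoids T m \<and> {i. multidegree m i > 0} \<subseteq> W"
    and coarser: "\<And>u v. u \<in> W \<Longrightarrow> v \<in> W \<Longrightarrow> h u = h v \<Longrightarrow> h' u = h' v"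
  shows "param T' h' f = 0"
proof -
  define r where "r l = h' (inv_into W h l)" for l
  have r: "r (h u) = h' u" if "u \<in> W" for u
    unfolding r_def using that by (intro coarser inv_into_into f_inv_into_f) auto
  have "param T' h' f = monomial_map (\<lambda>w. \<forall>i\<in>T'. lookup w (X i) = 0) (relabel r) (param T h f)"
    unfolding param_def
  proof (rule monomial_map_comp[symmetric])
    fix m assume m: "m \<in> keys f"
    show "avoids T' m \<longleftrightarrow> avoids T m \<and> (\<forall>i\<in>T'. lookup (param_mono h m) (X i) = 0)"
      using keys[OF m] by (auto simp: avoids_def lookup_param_mono_X)
    assume "avoids T' m"
    then show "relabel r (param_mono h m) = param_mono h' m"
      unfolding relabel_param_mono using keys[OF m] r by (intro param_mono_cong) auto
  qed
  then show ?thesis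
    using assms(1) by simp
qed

definition multidegree_part :: "(nat \<Rightarrow> nat) \<Rightarrow> mpoly \<Rightarrow> mpoly" where
  "multidegree_part a = monomial_map (\<lambda>m. multidegree m = a) id"

lemma keys_multidegree_part: "keys (multidegree_part a f) = {m \<in> keys f. multidegree m = a}"
  unfolding multidegree_part_def by (rule keys_monomial_map_id)

lemma sum_multidegree_part: "f = (\<Sum>a\<in>multidegree ` keys f. multidegree_part a f)"
  unfolding multidegree_part_def by (rule sum_monomial_map_fibres)

lemma param_multidegree_part:
  "param T h (multidegree_part a f) = monomial_map (\<lambda>w. (\<lambda>i. lookup w (X i)) = a) id (param T h f)"
proof -
  let ?C = "\<lambda>m. multidegree m = a \<and> avoids T m"
  have "param T h (multidegree_part a f) = monomial_map ?C (param_mono h) f"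
    unfolding param_def multidegree_part_def by (rule monomial_map_comp) simp_all
  also have "\<dots> = monomial_map (\<lambda>w. (\<lambda>i. lookup w (X i)) = a) id (param T h f)"
    unfolding param_def by (rule monomial_map_comp[symmetric]) (auto simp: lookup_param_mono_X)
  finally show ?thesis .
qed

lemma exists_param_multidegree_part_nonzero:
  assumes "param T h f \<noteq> 0"
  shows "\<exists>a. param T h (multidegree_part a f) \<noteq> 0"
proof -
  obtain w where "w \<in> keys (param T h f)"
    using assms by (auto simp flip: keys_eq_empty)
  then have "w \<in> keys (param T h (multidegree_part (\<lambda>i. lookup w (X i)) f))"
    by (simp add: param_multidegree_part keys_monomial_map_id)
  then show ?thesis by (metis keys_zero empty_iff)
qed

lemma param_multidegree_part_avoiding:
  assumes "\<And>i. i \<in> T \<Longrightarrow> a i = 0"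
  shows "param T h (multidegree_part a f) = param {} h (multidegree_part a f)"
  unfolding param_def using assms
  by (intro monomial_map_cong) (auto simp: keys_multidegree_part avoids_def)

lemma param_multidegree_part_fun_upd:
  assumes "a c = 1"
  obtains G H where "\<And>l. param {} (h(c := l)) (multidegree_part a f) = G + indet (Y l) * H"
proof
  let ?g = "multidegree_part a f" and ?m' = "\<lambda>m. m - single (Y c) 1"
  let ?g\<^sub>0 = "\<lambda>m z. if lookup m (Y c) = 0 then single (param_mono h m) z else 0"
  let ?g\<^sub>1 = "\<lambda>m z. if lookup m (Y c) \<noteq> 0
    then single (single (X c) 1 + param_mono h (?m' m)) z else 0"
  fix l
  have "single (param_mono (h(c := l)) m) z = ?g\<^sub>0 m z + indet (Y l) * ?g\<^sub>1 m z"
    if m: "multidegree m c = 1" for m and z :: complex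
  proof (cases "lookup m (Y c) = 0")
    case True
    have "param_mono (h(c := l)) m = param_mono h m"
      unfolding param_mono_def using True
      by (intro additive_ext_cong) (auto simp: in_keys_iff split: var.splits)
    then show ?thesis using True by simp
  next
    case False
    then obtain k where k: "m = k + single (Y c) 1" by (metis obtain_single_summand gr0I)
    then have "multidegree k c = 0" using m by (simp add: multidegree_add)
    then have "param_mono (h(c := l)) k = param_mono h k" by (intro param_mono_cong) auto
    then show ?thesis
      using False by (simp add: k param_mono_add param_mono_single_Y[unfolded One_nat_def] indet_def
        mult_single ac_simps)
  qed
  then have "param {} (h(c := l)) ?g = additive_ext (\<lambda>m z. ?g\<^sub>0 m z + indet (Y l) * ?g\<^sub>1 m z) ?g"
    unfolding param_def monomial_map_def using assms
    by (intro additive_ext_cong) (simp add: keys_multidegree_part)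
  then show "param {} (h(c := l)) ?g = additive_ext ?g\<^sub>0 ?g + indet (Y l) * additive_ext ?g\<^sub>1 ?g"
    by (simp add: additive_ext_def sum.distrib sum_distrib_left cong: if_cong)
qed

subsection \<open>The polynomial ring\<close>

text \<open>
  The order is immaterial, but poly mappings are only known to form an integral domain when their
  indeterminates are linearly ordered.
\<close>

instantiation var :: linorder
begin

definition "v \<le> w \<longleftrightarrow> (case (v, w) of
   (X i, X j) \<Rightarrow> i \<le> j | (X _, Y _) \<Rightarrow> True | (Y _, X _) \<Rightarrow> False | (Y i, Y j) \<Rightarrow> i \<le> j)"

definition "v < w \<longleftrightarrow> v \<le> w \<and> \<not> w \<le> (v :: var)"

instance
  by standard (auto simp: less_eq_var_def less_var_def split: var.splits)

end

lemma poly_ring_simps [simp]: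
  "mult (poly_ring n) = (*)" "one (poly_ring n) = 1" "zero (poly_ring n) = 0" "add (poly_ring n) = (+)"
  by (simp_all add: poly_ring_def)

lemma carrier_iff: "f \<in> carrier (poly_ring n) \<longleftrightarrow> (\<forall>m\<in>keys f. keys m \<subseteq> vars n)"
  by (simp add: poly_ring_def)

lemma carrier_zero [simp]: "0 \<in> carrier (poly_ring n)"
  and carrier_one [simp]: "1 \<in> carrier (poly_ring n)"
  by (auto simp: carrier_iff)

lemma carrier_add:
  "f \<in> carrier (poly_ring n) \<Longrightarrow> g \<in> carrier (poly_ring n) \<Longrightarrow> f + g \<in> carrier (poly_ring n)"
  using Poly_Mapping.keys_add[of f g] by (auto simp: carrier_iff)

lemma carrier_uminus: "f \<in> carrier (poly_ring n) \<Longrightarrow> - f \<in> carrier (poly_ring n)"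
  by (simp add: carrier_iff)

lemma carrier_diff:
  "f \<in> carrier (poly_ring n) \<Longrightarrow> g \<in> carrier (poly_ring n) \<Longrightarrow> f - g \<in> carrier (poly_ring n)"
  using keys_diff[of f g] by (auto simp: carrier_iff)

lemma carrier_mult:
  assumes "f \<in> carrier (poly_ring n)" "g \<in> carrier (poly_ring n)"
  shows "f * g \<in> carrier (poly_ring n)"
  unfolding carrier_iff
proof
  fix m assume "m \<in> keys (f * g)"
  then obtain a b where "m = a + b" "a \<in> keys f" "b \<in> keys g"
    using Poly_Mapping.keys_mult[of f g] by auto
  then show "keys m \<subseteq> vars n"
    using assms by (simp add: carrier_iff keys_add_eq_Un)
qed

lemma carrier_prod:
  "(\<And>a. a \<in> A \<Longrightarrow> F a \<in> carrier (poly_ring n)) \<Longrightarrow> prod F A \<in> carrier (poly_ring n)"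
  by (induction A rule: infinite_finite_induct) (simp_all add: carrier_mult)

lemma carrier_single: "keys m \<subseteq> vars n \<Longrightarrow> single m c \<in> carrier (poly_ring n)"
  by (simp add: carrier_iff)

lemma carrier_indet: "v \<in> vars n \<Longrightarrow> indet v \<in> carrier (poly_ring n)"
  unfolding indet_def by (simp add: carrier_single)

lemma carrier_multidegree_part:
  "f \<in> carrier (poly_ring n) \<Longrightarrow> multidegree_part a f \<in> carrier (poly_ring n)"
  by (simp add: carrier_iff keys_multidegree_part)

lemma cring_poly_ring: "cring (poly_ring n)"
proof (rule cringI)
  show "abelian_group (poly_ring n)"
  proof (rule abelian_groupI)
    fix f assume "f \<in> carrier (poly_ring n)"
    then show "\<exists>g\<in>carrier (poly_ring n). g \<oplus>\<^bsub>poly_ring n\<^esub> f = \<zero>\<^bsub>poly_ring n\<^esub>"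
      using carrier_uminus by (intro bexI[of _ "- f"]) auto
  qed (simp_all add: carrier_add ac_simps)
  show "Group.comm_monoid (poly_ring n)"
    by (rule comm_monoidI) (simp_all add: carrier_mult ac_simps)
qed (simp add: distrib_right)

lemma ring_poly_ring: "ring (poly_ring n)"
  using cring_poly_ring cring.axioms(1) by blast

lemma a_inv_poly_ring: "f \<in> carrier (poly_ring n) \<Longrightarrow> \<ominus>\<^bsub>poly_ring n\<^esub> f = - f"
  using abelian_group.minus_equality[OF ring.is_abelian_group[OF ring_poly_ring[of n]], of "- f" f]
  by (simp add: carrier_uminus)

lemma ideal_poly_ring_iff:
  "ideal I (poly_ring n) \<longleftrightarrow> I \<subseteq> carrier (poly_ring n) \<and> 0 \<in> I \<and> (\<forall>f\<in>I. \<forall>g\<in>I. f + g \<in> I) \<and>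
    (\<forall>f\<in>I. \<forall>g\<in>carrier (poly_ring n). g * f \<in> I)" (is "?L \<longleftrightarrow> ?R")
proof
  assume ?L
  then interpret ideal I "poly_ring n" .
  show ?R
    using a_subset additive_subgroup.zero_closed[OF is_additive_subgroup]
      additive_subgroup.a_closed[OF is_additive_subgroup] I_l_closed by auto
next
  assume R: ?R
  have "- f \<in> I" if "f \<in> I" for f
  proof -
    have "(- 1) * f \<in> I" using R that carrier_uminus[OF carrier_one] by blast
    then show ?thesis by simp
  qed
  then have "subgroup I (add_monoid (poly_ring n))"
    using R a_inv_poly_ring unfolding subgroup_def a_inv_def by auto
  then show ?L
    using R by (intro idealI ring_poly_ring) (auto simp: mult.commute)
qed

lemma ideal_sum_mem:
  assumes "ideal I (poly_ring n)" "\<And>a. a \<in> A \<Longrightarrow> F a \<in> I"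
  shows "sum F A \<in> I"
  using assms(2) assms(1)[unfolded ideal_poly_ring_iff]
  by (induction A rule: infinite_finite_induct) auto

lemma mem_ideal_if_fibres_congruent:
  assumes ideal: "ideal I (poly_ring n)" and zero: "monomial_map (\<lambda>_. True) \<theta> f = 0"
    and cong: "\<And>m m'. \<lbrakk>m \<in> keys f; m' \<in> keys f; \<theta> m = \<theta> m'\<rbrakk> \<Longrightarrow> single m 1 - single m' 1 \<in> I"
  shows "f \<in> I"
proof -
  define r where "r = inv_into (keys f) \<theta>"
  have r: "r (\<theta> m) \<in> keys f" "\<theta> (r (\<theta> m)) = \<theta> m" if "m \<in> keys f" for m
    unfolding r_def using that by (auto intro: inv_into_into f_inv_into_f)
  have "monomial_map (\<lambda>_. True) (r \<circ> \<theta>) f = monomial_map (\<lambda>_. True) r (monomial_map (\<lambda>_. True) \<theta> f)"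
    by (rule monomial_map_comp[symmetric]) simp_all
  then have "f = additive_ext single f - monomial_map (\<lambda>_. True) (r \<circ> \<theta>) f"
    by (simp add: zero additive_ext_self)
  also have "\<dots> = (\<Sum>m\<in>keys f. single 0 (lookup f m) * (single m 1 - single (r (\<theta> m)) 1))"
    by (simp add: monomial_map_def additive_ext_def right_diff_distrib mult_single sum_subtractf)
  also have "\<dots> \<in> I"
  proof (rule ideal_sum_mem[OF ideal])
    fix m assume "m \<in> keys f"
    then have "single m 1 - single (r (\<theta> m)) 1 \<in> I" using r cong by metis
    then show "single 0 (lookup f m) * (single m 1 - single (r (\<theta> m)) 1) \<in> I"
      using ideal carrier_single[of 0 n] by (simp add: ideal_poly_ring_iff)
  qed
  finally show ?thesis .
qed

lemma (in primeideal) subset_if_Inter_subset: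
  assumes "finite F" "\<And>K. K \<in> F \<Longrightarrow> ideal K R" "carrier R \<inter> \<Inter>F \<subseteq> I"
  shows "\<exists>K\<in>F. K \<subseteq> I"
  using assms
proof (induction F rule: finite_induct)
  case empty
  then show ?case using a_subset I_notcarr by auto
next
  case (insert K F)
  show ?case
  proof (cases "K \<subseteq> I")
    case False
    then obtain x where x: "x \<in> K" "x \<notin> I" by blast
    interpret K: ideal K R using insert.prems by simp
    have "carrier R \<inter> \<Inter>F \<subseteq> I"
    proof
      fix y assume y: "y \<in> carrier R \<inter> \<Inter>F"
      have xR: "x \<in> carrier R" using x K.a_subset by blast
      have "x \<otimes> y \<in> L" if "L \<in> F" for L
        using ideal.I_l_closed[of L R] insert.prems(1) that y xR by auto
      moreover have "x \<otimes> y \<in> K" using x y K.I_r_closed by auto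
      ultimately have "x \<otimes> y \<in> I" using insert.prems(2) xR y by auto
      then show "y \<in> I" using I_prime[OF xR, of y] x y by blast
    qed
    then show ?thesis using insert by auto
  qed auto
qed

subsection \<open>Kernels of the parametrisations\<close>

definition param_ker :: "nat \<Rightarrow> nat set \<Rightarrow> (nat \<Rightarrow> nat) \<Rightarrow> mpoly set" where
  "param_ker n T h = {f \<in> carrier (poly_ring n). param T h f = 0}"

lemma ideal_param_ker: "ideal (param_ker n T h) (poly_ring n)"
  unfolding ideal_poly_ring_iff param_ker_def
  by (auto simp: carrier_add carrier_mult param_add param_mult)

lemma primeideal_param_ker: "primeideal (param_ker n T h) (poly_ring n)"
proof (rule primeidealI[OF ideal_param_ker cring_poly_ring])
  have "1 \<in> carrier (poly_ring n) - param_ker n T h" by (simp add: param_ker_def)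
  then show "carrier (poly_ring n) \<noteq> param_ker n T h" by blast
qed (auto simp: param_ker_def param_mult)

definition minor :: "nat \<Rightarrow> nat \<Rightarrow> mpoly" where
  "minor u v = indet (X u) * indet (Y v) - indet (X v) * indet (Y u)"

lemma carrier_minor: "u \<in> {1..n} \<Longrightarrow> v \<in> {1..n} \<Longrightarrow> minor u v \<in> carrier (poly_ring n)"
  unfolding minor_def by (intro carrier_diff carrier_mult carrier_indet) simp_all

lemma indet_eq_iff [simp]: "indet v = indet w \<longleftrightarrow> v = w"
  by (simp add: indet_def single_one_inject[where 'b = nat, unfolded One_nat_def])

lemma indet_nonzero [simp]: "indet v \<noteq> 0"
  by (simp add: indet_def flip: keys_eq_empty)

lemma param_minor_eq_0_iff: "param T h (minor u v) = 0 \<longleftrightarrow> u \<in> T \<or> v \<in> T \<or> h u = h v"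
proof (cases "u \<in> T \<or> v \<in> T")
  case True
  then show ?thesis by (auto simp: minor_def param_diff param_mult param_indet_X param_indet_Y)
next
  case False
  then have "param T h (minor u v) = indet (X u) * indet (X v) * (indet (Y (h v)) - indet (Y (h u)))"
    by (simp add: minor_def param_diff param_mult param_indet_X param_indet_Y algebra_simps)
  then show ?thesis using False by auto
qed

lemma mono_eqI:
  assumes "multidegree m = multidegree m'" "\<And>i. lookup m (Y i) = lookup m' (Y i)"
  shows "m = m'"
proof (rule poly_mapping_eqI)
  fix v
  show "lookup m v = lookup m' v"
    using fun_cong[OF assms(1)] assms(2) by (cases v) (simp_all add: multidegree_def)
qed

lemma multidegree_eq_if_param_mono_eq:
  "param_mono h m = param_mono h m' \<Longrightarrow> multidegree m = multidegree m'"
  by (rule ext) (metis lookup_param_mono_X)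

lemma obtain_unbalanced_pair:
  assumes eq: "param_mono h m = param_mono h m'" and vars: "keys m \<subseteq> vars n" "keys m' \<subseteq> vars n"
    and neq: "m \<noteq> m'"
  obtains k u v where "m = k + single (Y u) 1 + single (X v) 1" "u \<in> {1..n}" "v \<in> {1..n}"
    "h u = h v" "lookup m' (Y u) < lookup m (Y u)" "lookup m (Y v) < lookup m' (Y v)"
proof -
  have deg: "multidegree m = multidegree m'" by (rule multidegree_eq_if_param_mono_eq[OF eq])
  then obtain i where i: "lookup m (Y i) \<noteq> lookup m' (Y i)"
    using mono_eqI neq by blast
  let ?A = "{j. j \<in> {1..n} \<and> h j = h i}"
  have "Y i \<in> vars n" using i vars by (metis in_keys_iff subsetD)
  then have iA: "i \<in> ?A" "finite ?A" by simp_all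
  have sums: "(\<Sum>j\<in>?A. lookup m (Y j)) = (\<Sum>j\<in>?A. lookup m' (Y j))"
    using eq lookup_param_mono_Y[OF vars(1)] lookup_param_mono_Y[OF vars(2)] by metis
  obtain u where u: "u \<in> ?A" "lookup m' (Y u) < lookup m (Y u)"
    using sum_mono_inv[OF sums _ iA] i by (meson not_le)
  obtain v where v: "v \<in> ?A" "lookup m (Y v) < lookup m' (Y v)"
    using sum_mono_inv[OF sums[symmetric] _ iA] i by (metis not_le)
  obtain k\<^sub>1 where k\<^sub>1: "m = k\<^sub>1 + single (Y u) 1"
    using u(2) by (metis obtain_single_summand gr_implies_not0 gr0I)
  have "lookup m (X v) > 0"
    using v(2) fun_cong[OF deg, of v] by (simp add: multidegree_def)
  then have "lookup k\<^sub>1 (X v) > 0" by (simp add: k\<^sub>1 lookup_add lookup_single)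
  then obtain k where "k\<^sub>1 = k + single (X v) 1" by (elim obtain_single_summand)
  then have "m = k + single (Y u) 1 + single (X v) 1" by (simp add: k\<^sub>1 ac_simps)
  then show ?thesis using that u v by simp
qed

subsection \<open>Components after deleting vertices\<close>

locale graph_on =
  fixes n :: nat and E :: "nat set set"
  assumes edges_subset: "\<Union>E \<subseteq> {1..n}"
begin

definition edges_avoiding :: "nat set \<Rightarrow> (nat \<times> nat) set" where
  "edges_avoiding T = {(u, v). {u, v} \<in> E \<and> u \<notin> T \<and> v \<notin> T}"

definition comp_label :: "nat set \<Rightarrow> nat \<Rightarrow> nat" where
  "comp_label T u = (LEAST v. (u, v) \<in> (edges_avoiding T)\<^sup>*)"

definition locally_constant :: "nat set \<Rightarrow> (nat \<Rightarrow> nat) \<Rightarrow> bool" where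
  "locally_constant T h \<longleftrightarrow> (\<forall>(u, v)\<in>edges_avoiding T. h u = h v)"

lemma comp_label_eq_iff: "comp_label T u = comp_label T v \<longleftrightarrow> (u, v) \<in> (edges_avoiding T)\<^sup>*"
proof
  have label: "(u, comp_label T u) \<in> (edges_avoiding T)\<^sup>*" for u
    unfolding comp_label_def by (rule LeastI[of _ u]) simp
  have sym: "sym ((edges_avoiding T)\<^sup>*)"
    by (rule sym_rtrancl) (auto simp: edges_avoiding_def sym_def insert_commute)
  show "(u, v) \<in> (edges_avoiding T)\<^sup>*" if "comp_label T u = comp_label T v"
    using label[of u] label[of v] that sym by (metis rtrancl_trans symE)
  assume "(u, v) \<in> (edges_avoiding T)\<^sup>*"
  then have "(u, w) \<in> (edges_avoiding T)\<^sup>* \<longleftrightarrow> (v, w) \<in> (edges_avoiding T)\<^sup>*" for w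
    using sym by (meson rtrancl_trans symE)
  then show "comp_label T u = comp_label T v" by (simp add: comp_label_def)
qed

lemma locally_constantI:
  "(\<And>u v. {u, v} \<in> E \<Longrightarrow> u \<notin> T \<Longrightarrow> v \<notin> T \<Longrightarrow> h u = h v) \<Longrightarrow> locally_constant T h"
  by (auto simp: locally_constant_def edges_avoiding_def)

lemma locally_constantD:
  assumes "locally_constant T h" "comp_label T u = comp_label T v"
  shows "h u = h v"
  using assms(2)[unfolded comp_label_eq_iff] assms(1)
  by (induction rule: rtrancl_induct) (auto simp: locally_constant_def)

lemma comp_label_edge: "{u, v} \<in> E \<Longrightarrow> u \<notin> T \<Longrightarrow> v \<notin> T \<Longrightarrow> comp_label T u = comp_label T v"
  unfolding comp_label_eq_iff by (auto simp: edges_avoiding_def)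

lemma locally_constant_comp_label: "S \<subseteq> T \<Longrightarrow> locally_constant T (comp_label S)"
  by (intro locally_constantI comp_label_edge) auto

subsection \<open>Binomial edge ideals as intersections of primes\<close>

abbreviation "R \<equiv> poly_ring n"
abbreviation "J \<equiv> binomial_edge_ideal n E"

definition cut_prime :: "nat set \<Rightarrow> mpoly set" where
  "cut_prime T = param_ker n T (comp_label T)"

lemma cut_prime_iff: "f \<in> cut_prime T \<longleftrightarrow> f \<in> carrier R \<and> param T (comp_label T) f = 0"
  by (simp add: cut_prime_def param_ker_def)

lemma primeideal_cut_prime: "primeideal (cut_prime T) R"
  unfolding cut_prime_def by (rule primeideal_param_ker)

lemma edge_minors_subset_carrier: "{minor i j |i j. {i, j} \<in> E \<and> i < j} \<subseteq> carrier R"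
  using edges_subset by (fastforce intro: carrier_minor)

lemma ideal_binomial_edge_ideal: "ideal J R"
  unfolding binomial_edge_ideal_def minor_def[symmetric]
  using edge_minors_subset_carrier by (rule ring.genideal_ideal[OF ring_poly_ring])

lemma edge_minor_in_binomial_edge_ideal:
  assumes "{u, v} \<in> E"
  shows "minor u v \<in> J"
proof -
  have ordered: "minor i j \<in> J" if "{i, j} \<in> E" "i < j" for i j
    using ring.genideal_self[OF ring_poly_ring edge_minors_subset_carrier] that
    unfolding binomial_edge_ideal_def minor_def[symmetric] by blast
  consider (less) "u < v" | (equal) "u = v" | (greater) "v < u" by linarith
  then show ?thesis
  proof cases
    case less
    then show ?thesis using ordered assms by simp
  next
    case equal
    then show ?thesis using ideal_binomial_edge_ideal by (simp add: minor_def ideal_poly_ring_iff)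
  next
    case greater
    then have "minor v u \<in> J" using ordered[of v u] assms by (simp add: insert_commute)
    then have "(- 1) * minor v u \<in> J"
      using ideal_binomial_edge_ideal carrier_uminus[OF carrier_one]
      unfolding ideal_poly_ring_iff by blast
    then show ?thesis by (simp add: minor_def)
  qed
qed

lemma binomial_edge_ideal_subset_param_ker:
  assumes "locally_constant T h"
  shows "J \<subseteq> param_ker n T h"
  unfolding binomial_edge_ideal_def minor_def[symmetric]
proof (rule ring.genideal_minimal[OF ring_poly_ring ideal_param_ker])
  have "param T h (minor i j) = 0" if "{i, j} \<in> E" for i j
    using assms that by (auto simp: param_minor_eq_0_iff locally_constant_def edges_avoiding_def)
  then show "{minor i j |i j. {i, j} \<in> E \<and> i < j} \<subseteq> param_ker n T h"
    using edge_minors_subset_carrier unfolding param_ker_def by blast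
qed

definition mono_cong :: "mono \<Rightarrow> mono \<Rightarrow> bool" where
  "mono_cong m m' \<longleftrightarrow> single m 1 - single m' 1 \<in> J"

lemma mono_cong_refl [simp]: "mono_cong m m"
  using ideal_binomial_edge_ideal by (simp add: mono_cong_def ideal_poly_ring_iff)

lemma mono_cong_trans:
  assumes "mono_cong a b" "mono_cong b c"
  shows "mono_cong a c"
proof -
  have "(single a 1 - single b 1) + (single b 1 - single c 1) \<in> J"
    using assms ideal_binomial_edge_ideal unfolding mono_cong_def ideal_poly_ring_iff by blast
  then show ?thesis by (simp add: mono_cong_def)
qed

definition swappable :: "mono \<Rightarrow> nat \<Rightarrow> nat \<Rightarrow> bool" where
  "swappable k u v \<longleftrightarrow>
    mono_cong (k + single (Y u) 1 + single (X v) 1) (k + single (X u) 1 + single (Y v) 1)"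

lemma swappable_refl: "swappable k u u"
  by (simp add: swappable_def ac_simps)

lemma swappable_edge:
  assumes "{u, v} \<in> E" "keys k \<subseteq> vars n"
  shows "swappable k u v"
proof -
  have "single k 1 * minor v u \<in> J"
    using ideal_binomial_edge_ideal edge_minor_in_binomial_edge_ideal[of v u] assms
      carrier_single[of k n 1]
    unfolding ideal_poly_ring_iff by (metis insert_commute)
  then show ?thesis
    by (simp add: swappable_def mono_cong_def minor_def indet_def mult_single right_diff_distrib ac_simps)
qed

lemma swappable_via_X:
  assumes "swappable (k + single (X v) 1) u w" "swappable (k + single (X u) 1) w v"
  shows "swappable (k + single (X w) 1) u v"
  using assms unfolding swappable_def by (simp add: ac_simps) (erule (1) mono_cong_trans)

lemma swappable_via_Y:
  assumes "swappable (k + single (Y u) 1) w v" "swappable (k + single (Y v) 1) u w"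
  shows "swappable (k + single (Y w) 1) u v"
  using assms unfolding swappable_def by (simp add: ac_simps) (erule (1) mono_cong_trans)

text \<open>
  Think of the exponent of \<open>y\<^sub>i\<close> as a number of tokens on vertex \<open>i\<close>, whose capacity is the total
  degree in \<open>x\<^sub>i, y\<^sub>i\<close>. An edge generator moves one token along an edge; a full vertex on the way
  is no obstacle, since it can first pass on one of its own tokens.
\<close>

lemma swappable_connected:
  assumes "(u, v) \<in> (edges_avoiding T)\<^sup>*"
    and "keys k \<subseteq> vars n" "u \<in> {1..n}" "v \<in> {1..n}"
    and "\<And>w. w \<in> {1..n} - T \<Longrightarrow> w = u \<or> w = v \<or> multidegree k w > 0"
  shows "swappable k u v"
  using assms
proof (induction arbitrary: k rule: converse_rtrancl_induct)
  case base
  show ?case by (rule swappable_refl)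
next
  case (step u w)
  from step.hyps have edge: "{u, w} \<in> E" and w: "w \<in> {1..n} - T"
    using edges_subset by (auto simp: edges_avoiding_def)
  consider (start) "w = u" | (finish) "w = v" | (occupied) z where "z = X w \<or> z = Y w" "lookup k z > 0"
    using step.prems(4)[OF w] by (auto simp: multidegree_def)
  then show ?case
  proof cases
    case start
    then show ?thesis using step by simp
  next
    case finish
    then show ?thesis using swappable_edge edge step.prems(1) by simp
  next
    case occupied
    then obtain k' where k: "k = k' + single z 1" by (elim obtain_single_summand)
    have k': "keys k' \<subseteq> vars n" using step.prems(1) by (simp add: k keys_add_eq_Un)
    have pos: "x = u \<or> x = v \<or> x = w \<or> multidegree k' x > 0" if "x \<in> {1..n} - T" for x
      using step.prems(4)[OF that] occupied(1) by (auto simp: k multidegree_add split: if_splits)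
    have first: "swappable (k' + single y 1) u w" if "y = X v \<or> y = Y v" for y
      using that edge k' step.prems(3) by (intro swappable_edge) (auto simp: keys_add_eq_Un)
    have rest: "swappable (k' + single y 1) w v" if "y = X u \<or> y = Y u" for y
    proof (rule step.IH)
      show "keys (k' + single y 1) \<subseteq> vars n"
        using that k' step.prems(2) by (auto simp: keys_add_eq_Un)
      show "x = w \<or> x = v \<or> multidegree (k' + single y 1) x > 0" if "x \<in> {1..n} - T" for x
        using pos[OF that] \<open>y = X u \<or> y = Y u\<close> by (auto simp: multidegree_add)
    qed (use w step.prems(3) in auto)
    show ?thesis
      using occupied(1) swappable_via_X[OF first rest] swappable_via_Y[OF rest first] unfolding k
      by blast
  qed
qed

lemma mono_cong_if_param_mono_eq:
  assumes "param_mono (comp_label T) m = param_mono (comp_label T) m'"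
    and "keys m \<subseteq> vars n" "keys m' \<subseteq> vars n"
    and "\<And>w. w \<in> {1..n} - T \<Longrightarrow> multidegree m w > 0"
  shows "mono_cong m m'"
  using assms
proof (induction "\<Sum>i\<in>{1..n}. lookup m (Y i) - lookup m' (Y i)" arbitrary: m rule: less_induct)
  case less
  show ?case
  proof (cases "m = m'")
    case False
    obtain k u v where k: "m = k + single (Y u) 1 + single (X v) 1"
      and uv: "u \<in> {1..n}" "v \<in> {1..n}" "comp_label T u = comp_label T v"
      and u: "lookup m' (Y u) < lookup m (Y u)" and v: "lookup m (Y v) < lookup m' (Y v)"
      by (rule obtain_unbalanced_pair[OF less.prems(1-3) False])
    have "u \<noteq> v" using u v by auto
    define q where "q = k + single (X u) 1 + single (Y v) 1"
    have "swappable k u v"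
    proof (rule swappable_connected)
      show "(u, v) \<in> (edges_avoiding T)\<^sup>*" using uv(3) by (simp add: comp_label_eq_iff)
      show "keys k \<subseteq> vars n" using less.prems(2) by (simp add: k keys_add_eq_Un)
      show "w = u \<or> w = v \<or> multidegree k w > 0" if "w \<in> {1..n} - T" for w
        using less.prems(4)[OF that] by (auto simp: k multidegree_add split: if_splits)
    qed (fact uv(1,2))+
    then have "mono_cong m q" by (simp add: swappable_def k q_def)
    moreover have "mono_cong q m'"
    proof (rule less.hyps[OF _ _ _ less.prems(3)])
      have Y: "lookup q (Y j) = (if j = u then lookup m (Y j) - 1
          else if j = v then lookup m (Y j) + 1 else lookup m (Y j))" for j
        using \<open>u \<noteq> v\<close> by (auto simp: k q_def lookup_add lookup_single when_def)
      show "(\<Sum>i\<in>{1..n}. lookup q (Y i) - lookup m' (Y i)) <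
          (\<Sum>i\<in>{1..n}. lookup m (Y i) - lookup m' (Y i))"
        using u v uv(1) unfolding Y by (intro sum_strict_mono_ex1) auto
      show "param_mono (comp_label T) q = param_mono (comp_label T) m'"
        unfolding less.prems(1)[symmetric] k q_def
        by (simp add: param_mono_add param_mono_single_X param_mono_single_Y uv(3) ac_simps del: One_nat_def)
      show "keys q \<subseteq> vars n" using less.prems(2) uv(1,2) by (auto simp: k q_def keys_add_eq_Un)
      show "multidegree q w > 0" if "w \<in> {1..n} - T" for w
        using less.prems(4)[OF that] by (simp add: k q_def multidegree_add)
    qed
    ultimately show ?thesis by (rule mono_cong_trans)
  qed simp
qed

lemma multihomogeneous_mem_binomial_edge_ideal:
  assumes f: "f \<in> carrier R" "\<And>m. m \<in> keys f \<Longrightarrow> multidegree m = a"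
    and zero: "param {} (comp_label {i \<in> {1..n}. a i = 0}) f = 0"
  shows "f \<in> J"
proof (rule mem_ideal_if_fibres_congruent[OF ideal_binomial_edge_ideal])
  let ?h = "comp_label {i \<in> {1..n}. a i = 0}"
  show "monomial_map (\<lambda>_. True) (param_mono ?h) f = 0"
    using zero by (simp add: param_def)
  fix m m' assume m: "m \<in> keys f" "m' \<in> keys f" "param_mono ?h m = param_mono ?h m'"
  have "mono_cong m m'"
    using m f by (intro mono_cong_if_param_mono_eq[OF m(3)]) (auto simp: carrier_iff)
  then show "single m 1 - single m' 1 \<in> J" by (simp add: mono_cong_def)
qed

theorem binomial_edge_ideal_eq_Inter: "J = (\<Inter>T\<in>Pow {1..n}. cut_prime T)"
proof
  show "J \<subseteq> (\<Inter>T\<in>Pow {1..n}. cut_prime T)"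
    using binomial_edge_ideal_subset_param_ker locally_constant_comp_label
    unfolding cut_prime_def by blast
  show "(\<Inter>T\<in>Pow {1..n}. cut_prime T) \<subseteq> J"
  proof
    fix f assume f: "f \<in> (\<Inter>T\<in>Pow {1..n}. cut_prime T)"
    have "multidegree_part a f \<in> J" for a
    proof (rule multihomogeneous_mem_binomial_edge_ideal)
      let ?Z = "{i \<in> {1..n}. a i = 0}"
      show "multidegree_part a f \<in> carrier R"
        using f by (auto simp: cut_prime_iff carrier_multidegree_part)
      have "param ?Z (comp_label ?Z) f = 0" using f by (auto simp: cut_prime_iff)
      then have "param ?Z (comp_label ?Z) (multidegree_part a f) = 0"
        by (simp add: param_multidegree_part)
      then show "param {} (comp_label ?Z) (multidegree_part a f) = 0"
        by (subst (asm) param_multidegree_part_avoiding) auto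
    qed (simp add: keys_multidegree_part)
    then show "f \<in> J"
      using sum_multidegree_part[of f] ideal_sum_mem[OF ideal_binomial_edge_ideal] by metis
  qed
qed

subsection \<open>Prime colon ideals\<close>

lemma mult_mem_cut_prime_iff:
  "f \<in> carrier R \<Longrightarrow> g \<in> carrier R \<Longrightarrow> f * g \<in> cut_prime T \<longleftrightarrow> f \<in> cut_prime T \<or> g \<in> cut_prime T"
  by (auto simp: cut_prime_iff carrier_mult param_mult)

lemma prod_mem_cut_prime_iff:
  assumes "finite A" "\<And>a. a \<in> A \<Longrightarrow> F a \<in> carrier R"
  shows "prod F A \<in> cut_prime T \<longleftrightarrow> (\<exists>a\<in>A. F a \<in> cut_prime T)"
  using assms by (auto simp: cut_prime_iff carrier_prod param_prod)

lemma indet_X_mem_cut_prime_iff: "i \<in> {1..n} \<Longrightarrow> indet (X i) \<in> cut_prime T \<longleftrightarrow> i \<in> T"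
  by (simp add: cut_prime_iff carrier_indet param_indet_X)

lemma minor_mem_cut_prime_iff:
  "u \<in> {1..n} \<Longrightarrow> v \<in> {1..n} \<Longrightarrow>
    minor u v \<in> cut_prime T \<longleftrightarrow> u \<in> T \<or> v \<in> T \<or> comp_label T u = comp_label T v"
  by (simp add: cut_prime_iff carrier_minor param_minor_eq_0_iff)

lemma cut_prime_mono:
  assumes "S \<subseteq> T" "T \<subseteq> {1..n}"
    and "\<And>u v. \<lbrakk>u \<in> {1..n} - T; v \<in> {1..n} - T; comp_label S u = comp_label S v\<rbrakk> \<Longrightarrow>
      comp_label T u = comp_label T v"
  shows "cut_prime S \<subseteq> cut_prime T"
proof
  fix f assume "f \<in> cut_prime S"
  then have f: "f \<in> carrier R" "param S (comp_label S) f = 0" by (simp_all add: cut_prime_iff)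
  have "param T (comp_label T) f = 0"
  proof (rule param_eq_0_coarsen[OF f(2)])
    fix m assume m: "m \<in> keys f" "avoids T m"
    have "i \<in> {1..n} - T" if "multidegree m i > 0" for i
    proof -
      have "X i \<in> keys m \<or> Y i \<in> keys m" using that by (auto simp: multidegree_def in_keys_iff)
      then have "i \<in> {1..n}"
        using m(1) f(1) X_in_vars Y_in_vars unfolding carrier_iff by (metis subsetD)
      then show ?thesis using m(2) that by (auto simp: avoids_def)
    qed
    then show "avoids S m \<and> {i. multidegree m i > 0} \<subseteq> {1..n} - T"
      using m(2) assms(1) by (auto simp: avoids_def)
  qed (rule assms(3))
  then show "f \<in> cut_prime T" using f by (simp add: cut_prime_iff)
qed

lemma colon_eq_Inter:
  assumes "f \<in> carrier R"
  shows "colon R J f = carrier R \<inter> \<Inter>(cut_prime ` {T. T \<subseteq> {1..n} \<and> f \<notin> cut_prime T})"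
proof -
  have "g * f \<in> J \<longleftrightarrow> (\<forall>T\<in>{T. T \<subseteq> {1..n} \<and> f \<notin> cut_prime T}. g \<in> cut_prime T)"
    if "g \<in> carrier R" for g
    unfolding binomial_edge_ideal_eq_Inter using mult_mem_cut_prime_iff[OF that assms] by auto
  then show ?thesis by (auto simp: colon_def)
qed

lemma prime_colon_eq_cut_prime:
  assumes f: "f \<in> carrier R" and prime: "primeideal (colon R J f) R"
  obtains S where "S \<subseteq> {1..n}" "f \<notin> cut_prime S" "colon R J f = cut_prime S"
proof -
  let ?F = "{T. T \<subseteq> {1..n} \<and> f \<notin> cut_prime T}"
  have "\<exists>K\<in>cut_prime ` ?F. K \<subseteq> colon R J f"
  proof (rule primeideal.subset_if_Inter_subset[OF prime])
    show "carrier R \<inter> \<Inter>(cut_prime ` ?F) \<subseteq> colon R J f"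
      by (simp only: colon_eq_Inter[OF f] order_refl)
  qed (use primeideal_cut_prime primeideal.axioms(1) in auto)
  then obtain S where "S \<in> ?F" "cut_prime S \<subseteq> colon R J f" by blast
  moreover from this(1) have "colon R J f \<subseteq> cut_prime S" unfolding colon_eq_Inter[OF f] by blast
  ultimately show ?thesis using that by blast
qed

lemma colon_eq_cut_prime:
  assumes f: "f \<in> carrier R" and S: "S \<subseteq> {1..n}" "f \<notin> cut_prime S"
    and minimal: "\<And>T. T \<subseteq> {1..n} \<Longrightarrow> f \<notin> cut_prime T \<Longrightarrow> cut_prime S \<subseteq> cut_prime T"
  shows "colon R J f = cut_prime S"
  unfolding colon_eq_Inter[OF f] using S minimal by (auto simp: cut_prime_iff)

end

subsection \<open>Multidegrees of witnesses\<close>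

locale multigraded_witness = graph_on +
  fixes S :: "nat set" and f :: mpoly and a :: "nat \<Rightarrow> nat"
  assumes S_subset: "S \<subseteq> {1..n}"
    and cut_prime_subset_colon: "cut_prime S \<subseteq> colon R J f"
    and part_nonzero: "param S (comp_label S) (multidegree_part a f) \<noteq> 0"
begin

definition part_image :: "(nat \<Rightarrow> nat) \<Rightarrow> mpoly" where
  "part_image h = param {} h (multidegree_part a f)"

lemma degree_eq_0:
  assumes "s \<in> S"
  shows "a s = 0"
proof (rule ccontr)
  assume "a s \<noteq> 0"
  then have "param S (comp_label S) (multidegree_part a f) =
      monomial_map (\<lambda>_. False) id (multidegree_part a f)"
    unfolding param_def using assms
    by (intro monomial_map_cong) (auto simp: keys_multidegree_part avoids_def)
  then show False
    using part_nonzero by (simp add: monomial_map_def additive_ext_def)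
qed

lemma part_image_comp_label_nonzero: "part_image (comp_label S) \<noteq> 0"
  unfolding part_image_def using part_nonzero degree_eq_0
  by (subst param_multidegree_part_avoiding[symmetric, of S]) auto

lemma part_image_eq_0_coarsen:
  assumes "part_image h = 0" "\<And>u v. \<lbrakk>a u > 0; a v > 0; h u = h v\<rbrakk> \<Longrightarrow> h' u = h' v"
  shows "part_image h' = 0"
  unfolding part_image_def
proof (rule param_eq_0_coarsen[OF assms(1)[unfolded part_image_def]])
  show "avoids {} m \<and> {i. multidegree m i > 0} \<subseteq> {i. a i > 0}"
    if "m \<in> keys (multidegree_part a f)" for m
    using that by (simp add: keys_multidegree_part)
qed (rule assms(2); simp)

lemma part_image_eq_0_if_notin_param_ker:
  assumes h: "locally_constant T h" and T: "\<And>i. i \<in> T \<Longrightarrow> a i = 0"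
    and g: "g \<in> cut_prime S" "param T h g \<noteq> 0"
  shows "part_image h = 0"
proof -
  have "g * f \<in> param_ker n T h"
    using g(1) cut_prime_subset_colon binomial_edge_ideal_subset_param_ker[OF h]
    by (auto simp: colon_def)
  then have "param T h f = 0" using g(2) by (simp add: param_ker_def param_mult)
  then have "param T h (multidegree_part a f) = 0" by (simp add: param_multidegree_part)
  then show ?thesis unfolding part_image_def by (subst (asm) param_multidegree_part_avoiding[OF T])
qed

lemma part_image_eq_0_if_cut_vertex_kept:
  assumes "locally_constant T h" "\<And>i. i \<in> T \<Longrightarrow> a i = 0" "s \<in> S - T"
  shows "part_image h = 0"
proof (rule part_image_eq_0_if_notin_param_ker[OF assms(1,2)])
  show "indet (X s) \<in> cut_prime S" using assms(3) S_subset indet_X_mem_cut_prime_iff by blast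
  show "param T h (indet (X s)) \<noteq> 0" using assms(3) by (simp add: param_indet_X)
qed

lemma comp_label_eq_if_zeros:
  assumes "S \<subseteq> T" "\<And>i. i \<in> T \<Longrightarrow> a i = 0" "u \<in> {1..n} - T" "v \<in> {1..n} - T"
    and "comp_label S u = comp_label S v"
  shows "comp_label T u = comp_label T v"
proof (rule ccontr)
  assume neq: "comp_label T u \<noteq> comp_label T v"
  have "part_image (comp_label T) = 0"
  proof (rule part_image_eq_0_if_notin_param_ker[OF locally_constant_comp_label[OF order_refl] assms(2)])
    show "minor u v \<in> cut_prime S" using assms(3-5) by (simp add: minor_mem_cut_prime_iff)
    show "param T (comp_label T) (minor u v) \<noteq> 0"
      using assms(3,4) neq by (simp add: param_minor_eq_0_iff)
  qed
  then have "part_image (comp_label S) = 0"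
    by (rule part_image_eq_0_coarsen)
      (rule locally_constantD[OF locally_constant_comp_label[OF assms(1)]])
  then show False using part_image_comp_label_nonzero by simp
qed

lemma exists_separated_neighbours:
  assumes s: "s \<in> S"
  shows "\<exists>u v. {s, u} \<in> E \<and> {s, v} \<in> E \<and> a u > 0 \<and> a v > 0 \<and> comp_label S u \<noteq> comp_label S v"
proof (rule ccontr)
  assume none_separated: "\<not> ?thesis"
  define l where "l = comp_label S (SOME u. {s, u} \<in> E \<and> a u > 0)"
  have l: "comp_label S u = l" if "{s, u} \<in> E" "a u > 0" for u
    using someI[of "\<lambda>u. {s, u} \<in> E \<and> a u > 0" u] that none_separated unfolding l_def by blast
  define h where "h = (comp_label S)(s := l)"
  have "part_image h = 0"
  proof (rule part_image_eq_0_if_cut_vertex_kept)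
    show "locally_constant {i. a i = 0 \<and> i \<noteq> s} h"
    proof (rule locally_constantI)
      fix u v assume edge: "{u, v} \<in> E" and "u \<notin> {i. a i = 0 \<and> i \<noteq> s}" "v \<notin> {i. a i = 0 \<and> i \<noteq> s}"
      then have pos: "u = s \<or> a u > 0" "v = s \<or> a v > 0" by auto
      consider "u = s" "v = s" | "u = s" "a v > 0" "v \<noteq> s" | "v = s" "a u > 0" "u \<noteq> s"
        | "u \<noteq> s" "v \<noteq> s" "u \<notin> S" "v \<notin> S"
        using pos degree_eq_0 by fastforce
      then show "h u = h v"
        using edge l[of u] l[of v] comp_label_edge[OF edge, of S]
        by cases (auto simp: h_def insert_commute)
    qed
  qed (use s in auto)
  then have "part_image (comp_label S) = 0"
    by (rule part_image_eq_0_coarsen) (use degree_eq_0[OF s] in \<open>auto simp: h_def split: if_splits\<close>)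
  then show False using part_image_comp_label_nonzero by simp
qed

lemma part_image_eq_0_merge:
  assumes s: "s \<in> S" and c: "c \<notin> S" "\<And>w. {c, w} \<in> E \<Longrightarrow> w \<in> S"
    and l: "\<And>w. \<lbrakk>{s, w} \<in> E; w \<notin> S; w \<noteq> c\<rbrakk> \<Longrightarrow> comp_label S w = l"
  shows "part_image ((comp_label S)(c := l)) = 0"
proof -
  define h where "h = (comp_label S)(c := l, s := l)"
  have "part_image h = 0"
  proof (rule part_image_eq_0_if_cut_vertex_kept)
    show "locally_constant (S - {s}) h"
    proof (rule locally_constantI)
      fix u v assume edge: "{u, v} \<in> E" and uv: "u \<notin> S - {s}" "v \<notin> S - {s}"
      consider "u \<in> {s, c}" "v \<in> {s, c}" | "u = s" "v \<notin> S" "v \<noteq> c" | "v = s" "u \<notin> S" "u \<noteq> c"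
        | "u \<notin> S" "v \<notin> S" "u \<noteq> c" "v \<noteq> c"
        using uv c(2)[of u] c(2)[of v] edge insert_commute[of u v "{}"] s by fastforce
      then show "h u = h v"
        using edge s l[of u] l[of v] comp_label_edge[OF edge, of S]
        by cases (auto simp: h_def insert_commute)
    qed
  qed (use s degree_eq_0 in auto)
  then show ?thesis
    by (rule part_image_eq_0_coarsen) (use degree_eq_0[OF s] in \<open>auto simp: h_def split: if_splits\<close>)
qed

lemma part_image_eq_0_if_two_labels:
  assumes "a c = 1" "l \<noteq> l'" "part_image (h(c := l)) = 0" "part_image (h(c := l')) = 0"
  shows "part_image h = 0"
proof -
  obtain G H where GH: "\<And>l. part_image (h(c := l)) = G + indet (Y l) * H"
    unfolding part_image_def using param_multidegree_part_fun_upd[of a c, OF assms(1)] by metis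
  have "(indet (Y l) - indet (Y l')) * H = (G + indet (Y l) * H) - (G + indet (Y l') * H)"
    by (simp add: left_diff_distrib)
  then have "(indet (Y l) - indet (Y l')) * H = 0" using assms(3,4) by (simp flip: GH)
  then have "H = 0" using assms(2) by simp
  then have "G = 0" using assms(3) GH by simp
  have "part_image h = part_image (h(c := h c))" by simp
  also have "\<dots> = 0" unfolding GH by (simp add: \<open>G = 0\<close> \<open>H = 0\<close>)
  finally show ?thesis .
qed

end

subsection \<open>Cycles\<close>

locale cycle =
  fixes n :: nat
  assumes n_ge_4: "n \<ge> 4"
begin

definition right :: "nat \<Rightarrow> nat" where
  "right i = (if i = n then 1 else i + 1)"

definition left :: "nat \<Rightarrow> nat" where
  "left i = (if i = 1 then n else i - 1)"

lemma right_range: "i \<in> {1..n} \<Longrightarrow> right i \<in> {1..n}"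
  and left_range: "i \<in> {1..n} \<Longrightarrow> left i \<in> {1..n}"
  by (auto simp: right_def left_def)

lemma right_left: "i \<in> {1..n} \<Longrightarrow> right (left i) = i"
  and left_right: "i \<in> {1..n} \<Longrightarrow> left (right i) = i"
  by (auto simp: right_def left_def)

lemma neighbours_distinct:
  assumes "i \<in> {1..n}"
  shows "right i \<noteq> i" "left i \<noteq> i" "left i \<noteq> right i"
    "right (right i) \<noteq> i" "right (right i) \<noteq> left i"
  using assms n_ge_4 by (auto simp: right_def left_def split: if_splits)

lemma inj_on_right: "inj_on right {1..n}"
  by (rule inj_on_inverseI[where g = left]) (rule left_right)

lemma cycle_edges_eq: "cycle_edges n = {{i, right i} |i. i \<in> {1..n}}"
  by (simp add: cycle_edges_def right_def)

sublocale graph_on n "cycle_edges n"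
  by standard (use right_range in \<open>auto simp: cycle_edges_eq simp del: atLeastAtMost_iff\<close>)

lemma mem_cycle_edges_iff:
  assumes "u \<in> {1..n}"
  shows "{u, v} \<in> cycle_edges n \<longleftrightarrow> v = left u \<or> v = right u"
proof
  assume "{u, v} \<in> cycle_edges n"
  then obtain i where "i \<in> {1..n}" "{u, v} = {i, right i}" by (auto simp: cycle_edges_eq)
  then show "v = left u \<or> v = right u" using left_right by (metis doubleton_eq_iff)
next
  have edge: "{i, right i} \<in> cycle_edges n" if "i \<in> {1..n}" for i
    using that unfolding cycle_edges_eq by blast
  assume "v = left u \<or> v = right u"
  then show "{u, v} \<in> cycle_edges n"
    using edge[OF assms] edge[OF left_range[OF assms]]
    by (auto simp: right_left[OF assms] insert_commute)
qed

lemma locally_constant_cycleI: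
  assumes "\<And>i. \<lbrakk>i \<in> {1..n}; i \<notin> T; right i \<notin> T\<rbrakk> \<Longrightarrow> h i = h (right i)"
  shows "locally_constant T h"
proof (rule locally_constantI)
  fix u v assume "{u, v} \<in> cycle_edges n" "u \<notin> T" "v \<notin> T"
  moreover from this obtain i where i: "i \<in> {1..n}" "{u, v} = {i, right i}"
    by (auto simp: cycle_edges_eq)
  ultimately show "h u = h v" using assms[OF i(1)] by (metis doubleton_eq_iff)
qed

lemma comp_label_right:
  "\<lbrakk>i \<in> {1..n}; i \<notin> T; right i \<notin> T\<rbrakk> \<Longrightarrow> comp_label T (right i) = comp_label T i"
  by (rule comp_label_edge[symmetric]) (simp_all add: mem_cycle_edges_iff)

lemma comp_label_left:
  "\<lbrakk>i \<in> {1..n}; i \<notin> T; left i \<notin> T\<rbrakk> \<Longrightarrow> comp_label T (left i) = comp_label T i"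
  by (rule comp_label_edge[symmetric]) (simp_all add: mem_cycle_edges_iff)

lemma between_iff_if_comp_label_eq:
  assumes "i \<in> T" "j \<in> T" "i \<in> {1..n}" "j \<in> {1..n}" "comp_label T u = comp_label T v"
  shows "u \<in> {i<..<j} \<longleftrightarrow> v \<in> {i<..<j}"
proof -
  define h :: "nat \<Rightarrow> nat" where "h w = of_bool (w \<in> {i<..<j})" for w
  have "locally_constant T h"
  proof (rule locally_constant_cycleI)
    fix w assume w: "w \<in> {1..n}" "w \<notin> T" "right w \<notin> T"
    then have "w \<noteq> i" "w \<noteq> j" "right w \<noteq> i" "right w \<noteq> j" using assms(1,2) by auto
    then show "h w = h (right w)"
      using w(1) assms(3,4) by (auto simp: h_def right_def split: if_splits)
  qed
  then have "h u = h v" using assms(5) by (rule locally_constantD)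
  then show ?thesis unfolding h_def of_bool_eq_iff .
qed

lemma comp_label_left_neq_right:
  assumes "i \<in> T" "j \<in> T" "i \<noteq> j" "i \<in> {1..n}" "j \<in> {1..n}" "left i \<notin> T" "right i \<notin> T"
  shows "comp_label T (left i) \<noteq> comp_label T (right i)"
proof
  assume eq: "comp_label T (left i) = comp_label T (right i)"
  have neq: "left i \<noteq> j" "right i \<noteq> j" using assms by auto
  show False
  proof (cases "i < j")
    case True
    then have "right i \<in> {i<..<j}" "left i \<notin> {i<..<j}"
      using assms(4,5) neq by (auto simp: left_def right_def)
    then show False using between_iff_if_comp_label_eq[OF assms(1,2,4,5) eq] by blast
  next
    case False
    then have "left i \<in> {j<..<i}" "right i \<notin> {j<..<i}"
      using assms(3-5) neq by (auto simp: left_def right_def)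
    then show False using between_iff_if_comp_label_eq[OF assms(2,1,5,4) eq] by blast
  qed
qed

lemma pairwise_adjacent_card_le_2:
  assumes Z: "Z \<subseteq> {1..n}" "\<And>i j. \<lbrakk>i \<in> Z; j \<in> Z; i \<noteq> j\<rbrakk> \<Longrightarrow> j = left i \<or> j = right i"
  shows "card Z \<le> 2"
proof (cases "Z = {}")
  case False
  then obtain i where i: "i \<in> Z" by blast
  then have range: "i \<in> {1..n}" using Z(1) by blast
  have "\<not> (right i \<in> Z \<and> left i \<in> Z)"
    using Z(2)[of "right i" "left i"] neighbours_distinct[OF range] left_right[OF range] by metis
  then have "Z \<subseteq> {i, left i} \<or> Z \<subseteq> {i, right i}" using Z(2)[OF i] by blast
  then obtain x where "Z \<subseteq> {i, x}" by blast
  then have "card Z \<le> card {i, x}" by (intro card_mono) simp_all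
  also have "\<dots> \<le> 2" by (simp add: card_insert_if)
  finally show ?thesis .
qed simp

end

subsection \<open>The lower bound\<close>

lemma card_le_card_zeros_plus_sum:
  fixes a :: "'a \<Rightarrow> nat"
  assumes "finite A"
  shows "card A \<le> card {i \<in> A. a i = 0} + (\<Sum>i\<in>A. a i)"
proof -
  have "card A = (\<Sum>i\<in>A. 1)" by simp
  also have "\<dots> \<le> (\<Sum>i\<in>A. of_bool (a i = 0) + a i)" by (intro sum_mono) auto
  also have "\<dots> = card {i \<in> A. a i = 0} + (\<Sum>i\<in>A. a i)"
    using assms by (simp add: sum.distrib sum_of_bool_eq Int_def conj_commute)
  finally show ?thesis .
qed

locale cycle_witness = cycle n + multigraded_witness n "cycle_edges n" S f a for n S f a
begin

lemma neighbours_pos_separated: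
  assumes "s \<in> S"
  shows "a (left s) > 0" "a (right s) > 0" "comp_label S (left s) \<noteq> comp_label S (right s)"
proof -
  have "s \<in> {1..n}" using assms S_subset by blast
  then show "a (left s) > 0" "a (right s) > 0" "comp_label S (left s) \<noteq> comp_label S (right s)"
    using exists_separated_neighbours[OF assms] unfolding mem_cycle_edges_iff[OF \<open>s \<in> {1..n}\<close>]
    by auto
qed

lemma neighbours_notin:
  assumes "s \<in> S"
  shows "left s \<notin> S" "right s \<notin> S"
  using neighbours_pos_separated(1,2)[OF assms] degree_eq_0 by fastforce+

lemma neighbour_mem_if_zeros:
  assumes T: "S \<subseteq> T" "T \<subseteq> {1..n}" "\<And>i. i \<in> T \<Longrightarrow> a i = 0"
    and i: "i \<in> T - S" and j: "j \<in> T" "j \<noteq> i"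
  shows "left i \<in> T \<or> right i \<in> T"
proof (rule ccontr)
  assume "\<not> ?thesis"
  then have notin: "left i \<notin> T" "right i \<notin> T" by auto
  have range: "i \<in> {1..n}" "j \<in> {1..n}" using T(2) i j by auto
  have "comp_label S (left i) = comp_label S (right i)"
    using comp_label_left[OF range(1)] comp_label_right[OF range(1)] T(1) i notin
    by (metis DiffD2 subsetD)
  then have "comp_label T (left i) = comp_label T (right i)"
    using left_range[OF range(1)] right_range[OF range(1)] notin
    by (intro comp_label_eq_if_zeros[OF T(1,3)]) simp_all
  then show False using comp_label_left_neq_right[of i T j] i j range notin by blast
qed

lemma pos_outside_cut:
  assumes "S \<noteq> {}" "i \<in> {1..n} - S"
  shows "a i > 0"
proof (rule ccontr)
  assume "\<not> a i > 0"
  then have zero: "a i = 0" by simp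
  obtain s where s: "s \<in> S" using assms by auto
  have i: "i \<in> {1..n}" using assms by auto
  have "left i \<notin> S" "right i \<notin> S"
    using neighbours_pos_separated(2)[of "left i"] neighbours_pos_separated(1)[of "right i"] zero
      right_left[OF i] left_right[OF i] by auto
  then show False
    using neighbour_mem_if_zeros[of "insert i S" i s] S_subset s zero assms degree_eq_0
      neighbours_distinct[OF i] by auto
qed

lemma n_le_sum_plus_2_if_empty:
  assumes "S = {}"
  shows "n \<le> (\<Sum>i\<in>{1..n}. a i) + 2"
proof -
  have "card {i \<in> {1..n}. a i = 0} \<le> 2"
  proof (rule pairwise_adjacent_card_le_2)
    fix i j assume "i \<in> {i \<in> {1..n}. a i = 0}" "j \<in> {i \<in> {1..n}. a i = 0}" "i \<noteq> j"
    then show "j = left i \<or> j = right i"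
      using neighbour_mem_if_zeros[of "{i, j}" i j] assms neighbours_distinct[of i] by auto
  qed auto
  then show ?thesis using card_le_card_zeros_plus_sum[of "{1..n}" a] by simp
qed

lemma n_le_sum_plus_card_if_nonempty:
  assumes "S \<noteq> {}"
  shows "n \<le> (\<Sum>i\<in>{1..n}. a i) + card S"
proof -
  have "{i \<in> {1..n}. a i = 0} \<subseteq> S" using pos_outside_cut[OF assms] by fastforce
  then have "card {i \<in> {1..n}. a i = 0} \<le> card S"
    using S_subset finite_subset by (intro card_mono) auto
  then show ?thesis using card_le_card_zeros_plus_sum[of "{1..n}" a] by simp
qed

lemma comp_label_around_singleton_arc:
  assumes "s \<in> S" "right (right s) \<in> S" "card S \<ge> 3"
  shows "comp_label S (left s) \<noteq> comp_label S (right (right (right s)))"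
proof
  let ?t = "right (right s)"
  assume eq: "comp_label S (left s) = comp_label S (right ?t)"
  have "\<not> S \<subseteq> {s, ?t}"
  proof
    assume "S \<subseteq> {s, ?t}"
    then have "card S \<le> card {s, ?t}" by (intro card_mono) simp_all
    also have "\<dots> \<le> 2" by (simp add: card_insert_if)
    finally show False using assms(3) by simp
  qed
  then obtain r where r: "r \<in> S" "r \<noteq> s" "r \<noteq> ?t" by blast
  have range: "s \<in> {1..n}" "right s \<in> {1..n}" "?t \<in> {1..n}" "r \<in> {1..n}"
    using S_subset assms r right_range by blast+
  let ?T = "S - {s}"
  have notin: "left s \<notin> ?T" "right s \<notin> ?T" "right ?t \<notin> ?T" using neighbours_notin assms by blast+
  have "comp_label ?T (right s) = comp_label ?T s"
    by (rule comp_label_right[OF range(1) _ notin(2)]) simp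
  also have "\<dots> = comp_label ?T (left s)"
    by (rule comp_label_left[OF range(1) _ notin(1), symmetric]) simp
  also have "\<dots> = comp_label ?T (right ?t)"
    by (rule locally_constantD[OF locally_constant_comp_label eq]) blast
  finally have "comp_label ?T (left ?t) = comp_label ?T (right ?t)"
    by (simp add: left_right[OF range(2)])
  moreover have "comp_label ?T (left ?t) \<noteq> comp_label ?T (right ?t)"
    using assms(2) r range notin left_right[OF range(2)] neighbours_distinct(4)[OF range(1)]
    by (intro comp_label_left_neq_right[of _ _ r]) auto
  ultimately show False by simp
qed

text \<open>
  Putting back \<open>s\<close> or \<open>s + 2\<close> merges the arc \<open>{s + 1}\<close> with its left or right neighbouring arc. So the
  multigraded part vanishes for two values of the label of \<open>s + 1\<close>, which is impossible if it is
  linear in \<open>x\<^sub>s\<^sub>+\<^sub>1, y\<^sub>s\<^sub>+\<^sub>1\<close>.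
\<close>

lemma singleton_arc_ge_2:
  assumes s: "s \<in> S" "right (right s) \<in> S" and card: "card S \<ge> 3"
  shows "a (right s) \<ge> 2"
proof (rule ccontr)
  let ?c = "right s" and ?t = "right (right s)"
  have range: "s \<in> {1..n}" "?c \<in> {1..n}" "?t \<in> {1..n}" using S_subset s right_range by blast+
  have c: "?c \<notin> S" using neighbours_notin s by blast
  have isolated: "w \<in> S" if "{?c, w} \<in> cycle_edges n" for w
    using that s mem_cycle_edges_iff[OF range(2)] left_right[OF range(1)] by auto
  assume "\<not> a ?c \<ge> 2"
  then have "a ?c = 1" using neighbours_pos_separated(2)[OF s(1)] by linarith
  moreover note comp_label_around_singleton_arc[OF s card]
  moreover have "part_image ((comp_label S)(?c := comp_label S (left s))) = 0"
    by (rule part_image_eq_0_merge[OF s(1) c isolated])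
      (auto simp: mem_cycle_edges_iff[OF range(1)])
  moreover have "part_image ((comp_label S)(?c := comp_label S (right ?t))) = 0"
    by (rule part_image_eq_0_merge[OF s(2) c isolated])
      (auto simp: mem_cycle_edges_iff[OF range(3)] left_right[OF range(2)])
  ultimately have "part_image (comp_label S) = 0" by (rule part_image_eq_0_if_two_labels)
  then show False using part_image_comp_label_nonzero by simp
qed

lemma twice_card_le_sum:
  assumes "card S \<ge> 3"
  shows "2 * card S \<le> (\<Sum>i\<in>{1..n}. a i)"
proof -
  have fin: "finite S" using S_subset finite_subset by blast
  have inj: "inj_on right S" "inj_on right (right ` S)"
    using inj_on_right S_subset right_range
    by (auto intro: inj_on_subset simp del: atLeastAtMost_iff)
  have "2 * card S = (\<Sum>s\<in>S. 2)" by simp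
  also have "\<dots> \<le> (\<Sum>s\<in>S. a (right s) + a (right (right s)))"
  proof (rule sum_mono)
    fix s assume s: "s \<in> S"
    then have range: "right (right s) \<in> {1..n}" using S_subset right_range by blast
    show "2 \<le> a (right s) + a (right (right s))"
    proof (cases "right (right s) \<in> S")
      case True
      then show ?thesis using singleton_arc_ge_2[OF s True assms] by simp
    next
      case False
      then show ?thesis
        using pos_outside_cut[of "right (right s)"] range neighbours_pos_separated(2)[OF s] s
        by force
    qed
  qed
  also have "\<dots> = (\<Sum>i\<in>right ` S. a i) + (\<Sum>i\<in>right ` right ` S. a i)"
    by (simp add: sum.distrib sum.reindex inj)
  also have "\<dots> = (\<Sum>i\<in>right ` S \<union> right ` right ` S. a i)"
  proof (rule sum.union_disjoint[symmetric])
    have "S \<inter> right ` S = {}" using neighbours_notin by blast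
    then show "right ` S \<inter> right ` right ` S = {}"
      using inj_on_image_Int[OF inj_on_right, of S "right ` S"] S_subset right_range by blast
  qed (simp_all add: fin)
  also have "\<dots> \<le> (\<Sum>i\<in>{1..n}. a i)"
    using S_subset right_range by (intro sum_mono2) blast+
  finally show ?thesis .
qed

lemma sum_lower_bound: "2 * n \<le> 3 * (\<Sum>i\<in>{1..n}. a i) + 2"
proof -
  consider "S = {}" | "S \<noteq> {}" "card S \<le> 2" | "S \<noteq> {}" "card S \<ge> 3" by linarith
  then show ?thesis
    using n_le_sum_plus_2_if_empty n_le_sum_plus_card_if_nonempty twice_card_le_sum n_ge_4
    by cases auto
qed

end

subsection \<open>Homogeneous polynomials\<close>

lemma mon_degree_add: "mon_degree (m + m') = mon_degree m + mon_degree m'"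
  unfolding mon_degree_def by (rule setsum_keys_plus_distrib) simp_all

lemma mon_degree_eq_sum_multidegree:
  assumes "keys m \<subseteq> vars n"
  shows "mon_degree m = (\<Sum>i\<in>{1..n}. multidegree m i)"
proof -
  have "mon_degree m = (\<Sum>v\<in>vars n. lookup m v)"
    unfolding mon_degree_def using assms
    by (intro sum.mono_neutral_left) (auto simp: vars_def in_keys_iff)
  also have "\<dots> = (\<Sum>v\<in>X ` {1..n}. lookup m v) + (\<Sum>v\<in>Y ` {1..n}. lookup m v)"
    unfolding vars_def by (intro sum.union_disjoint) auto
  also have "\<dots> = (\<Sum>i\<in>{1..n}. multidegree m i)"
    by (simp add: sum.reindex inj_on_def multidegree_def sum.distrib)
  finally show ?thesis .
qed

lemma homogeneous_one: "homogeneous 0 1"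
  by (simp add: homogeneous_def mon_degree_def)

lemma homogeneous_indet: "homogeneous 1 (indet v)"
  by (simp add: homogeneous_def indet_def mon_degree_def)

lemma homogeneous_mult:
  assumes "homogeneous d f" "homogeneous e g"
  shows "homogeneous (d + e) (f * g)"
  unfolding homogeneous_def
proof
  fix m assume "m \<in> keys (f * g)"
  then obtain p q where "m = p + q" "p \<in> keys f" "q \<in> keys g"
    using Poly_Mapping.keys_mult[of f g] by auto
  then show "mon_degree m = d + e" using assms by (simp add: homogeneous_def mon_degree_add)
qed

lemma homogeneous_diff: "homogeneous d f \<Longrightarrow> homogeneous d g \<Longrightarrow> homogeneous d (f - g)"
  using keys_diff[of f g] by (auto simp: homogeneous_def)

lemma homogeneous_minor: "homogeneous 2 (minor u v)"
  unfolding minor_def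
  using homogeneous_mult[OF homogeneous_indet homogeneous_indet]
  by (intro homogeneous_diff) (simp_all add: numeral_2_eq_2)

lemma homogeneous_prod:
  assumes "\<And>a. a \<in> A \<Longrightarrow> homogeneous (d a) (F a)"
  shows "homogeneous (sum d A) (prod F A)"
  using assms
  by (induction A rule: infinite_finite_induct) (simp_all add: homogeneous_one homogeneous_mult)

definition prime_colon_degree :: "nat \<Rightarrow> mpoly set \<Rightarrow> nat \<Rightarrow> bool" where
  "prime_colon_degree n I d \<longleftrightarrow>
    (\<exists>f\<in>carrier (poly_ring n). homogeneous d f \<and> primeideal (colon (poly_ring n) I f) (poly_ring n))"

lemma v_number_eq_Least: "v_number n I = (LEAST d. prime_colon_degree n I d)"
  unfolding v_number_def prime_colon_degree_def Ass_def by (rule arg_cong[of _ _ Least]) auto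

lemma (in cycle) prime_colon_degree_lower_bound:
  assumes "prime_colon_degree n J d"
  shows "2 * n \<le> 3 * d + 2"
proof -
  obtain f where f: "f \<in> carrier R" "homogeneous d f" "primeideal (colon R J f) R"
    using assms by (auto simp: prime_colon_degree_def)
  obtain S where S: "S \<subseteq> {1..n}" "f \<notin> cut_prime S" "colon R J f = cut_prime S"
    using prime_colon_eq_cut_prime f(1,3) by blast
  then have "param S (comp_label S) f \<noteq> 0" using f(1) by (simp add: cut_prime_iff)
  then obtain a where a: "param S (comp_label S) (multidegree_part a f) \<noteq> 0"
    using exists_param_multidegree_part_nonzero by blast
  interpret cycle_witness n S f a
    by unfold_locales (use S a in auto)
  have "multidegree_part a f \<noteq> 0" using a by auto
  then obtain m where m: "m \<in> keys f" "multidegree m = a"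
    using keys_multidegree_part[of a f] by (auto simp flip: keys_eq_empty)
  then have "d = (\<Sum>i\<in>{1..n}. a i)"
    using f mon_degree_eq_sum_multidegree[of m n] by (simp add: homogeneous_def carrier_iff)
  then show ?thesis using sum_lower_bound by simp
qed

subsection \<open>The upper bound\<close>

lemma (in graph_on) prime_colon_degreeI:
  assumes "f \<in> carrier R" "homogeneous d f" "S \<subseteq> {1..n}" "f \<notin> cut_prime S"
    and "\<And>T. T \<subseteq> {1..n} \<Longrightarrow> f \<notin> cut_prime T \<Longrightarrow> S \<subseteq> T"
    and "\<And>T u v. \<lbrakk>T \<subseteq> {1..n}; f \<notin> cut_prime T; u \<in> {1..n} - T; v \<in> {1..n} - T;
      comp_label S u = comp_label S v\<rbrakk> \<Longrightarrow> comp_label T u = comp_label T v"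
  shows "prime_colon_degree n J d"
proof -
  have "colon R J f = cut_prime S"
    using assms by (intro colon_eq_cut_prime cut_prime_mono) blast+
  then show ?thesis
    unfolding prime_colon_degree_def using assms(1,2) primeideal_cut_prime by metis
qed

context cycle
begin

lemma comp_label_eq_if_subset_1_2:
  assumes "T \<subseteq> {1, 2}" "u \<in> {1..n} - T"
  shows "comp_label T u = comp_label T 3"
proof -
  have upper: "comp_label T i = comp_label T 3" if "3 \<le> i" "i \<le> n" for i
    using that
  proof (induction i rule: dec_induct)
    case (step i)
    then have "right i = Suc i" "i \<notin> T" "Suc i \<notin> T" using assms(1) by (auto simp: right_def)
    then show ?case using comp_label_right[of i T] step by simp
  qed simp
  have ends: "left 1 = n" "right 2 = 3" "n \<notin> T" "3 \<notin> T"
    using n_ge_4 assms(1) by (auto simp: left_def right_def)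
  consider (one) "u = 1" | (two) "u = 2" | (ge_3) "3 \<le> u" "u \<le> n" using assms(2) by fastforce
  then show ?thesis
  proof cases
    case one
    then show ?thesis using comp_label_left[of 1 T] upper[of n] ends assms(2) n_ge_4 by auto
  next
    case two
    then show ?thesis using comp_label_right[of 2 T] ends assms(2) by auto
  next
    case ge_3
    then show ?thesis by (rule upper)
  qed
qed

lemma prime_colon_degree_connected: "prime_colon_degree n J (n - 2)"
proof (rule prime_colon_degreeI)
  let ?f = "\<Prod>i\<in>{3..n}. indet (X i)"
  have mem: "?f \<in> cut_prime T \<longleftrightarrow> \<not> T \<inter> {3..n} = {}" for T
    by (subst prod_mem_cut_prime_iff) (auto simp: indet_X_mem_cut_prime_iff carrier_indet)
  show "?f \<in> carrier R" by (intro carrier_prod carrier_indet) simp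
  have "homogeneous (\<Sum>i\<in>{3..n}. 1) ?f" by (intro homogeneous_prod homogeneous_indet)
  then show "homogeneous (n - 2) ?f" by simp
  show "?f \<notin> cut_prime {}" by (simp add: mem)
  show "comp_label T u = comp_label T v"
    if "T \<subseteq> {1..n}" "?f \<notin> cut_prime T" "u \<in> {1..n} - T" "v \<in> {1..n} - T" for T u v
  proof -
    have "i \<in> {1, 2}" if "i \<in> T" for i
      using that \<open>T \<subseteq> {1..n}\<close> \<open>?f \<notin> cut_prime T\<close> unfolding mem by fastforce
    then have "T \<subseteq> {1, 2}" by blast
    then show ?thesis using comp_label_eq_if_subset_1_2 that(3,4) by metis
  qed
qed auto

definition far_from :: "nat set \<Rightarrow> nat set" where
  "far_from S = {i \<in> {1..n}. left i \<notin> S \<and> i \<notin> S \<and> right i \<notin> S}"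

definition cut_witness :: "nat set \<Rightarrow> mpoly" where
  "cut_witness S = (\<Prod>s\<in>S. minor (left s) (right s)) * (\<Prod>i\<in>far_from S. indet (X i))"

lemma finite_far_from: "finite (far_from S)"
  by (simp add: far_from_def)

lemma cut_witness_factors_carrier:
  assumes "S \<subseteq> {1..n}"
  shows "(\<Prod>s\<in>S. minor (left s) (right s)) \<in> carrier R" "(\<Prod>i\<in>far_from S. indet (X i)) \<in> carrier R"
proof -
  show "(\<Prod>s\<in>S. minor (left s) (right s)) \<in> carrier R"
    using assms left_range right_range by (intro carrier_prod carrier_minor) blast+
  show "(\<Prod>i\<in>far_from S. indet (X i)) \<in> carrier R"
    by (intro carrier_prod carrier_indet) (simp add: far_from_def)
qed

lemma homogeneous_cut_witness: "homogeneous (2 * card S + card (far_from S)) (cut_witness S)"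
  unfolding cut_witness_def
proof (rule homogeneous_mult)
  have "homogeneous (\<Sum>s\<in>S. 2) (\<Prod>s\<in>S. minor (left s) (right s))"
    by (intro homogeneous_prod homogeneous_minor)
  then show "homogeneous (2 * card S) (\<Prod>s\<in>S. minor (left s) (right s))" by (simp add: mult.commute)
  have "homogeneous (\<Sum>i\<in>far_from S. 1) (\<Prod>i\<in>far_from S. indet (X i))"
    by (intro homogeneous_prod homogeneous_indet)
  then show "homogeneous (card (far_from S)) (\<Prod>i\<in>far_from S. indet (X i))" by simp
qed

lemma cut_witness_notin_cut_prime_iff:
  assumes "S \<subseteq> {1..n}"
  shows "cut_witness S \<notin> cut_prime T \<longleftrightarrow> far_from S \<inter> T = {} \<and>
    (\<forall>s\<in>S. left s \<notin> T \<and> right s \<notin> T \<and> comp_label T (left s) \<noteq> comp_label T (right s))"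
proof -
  have range: "left s \<in> {1..n}" "right s \<in> {1..n}" if "s \<in> S" for s
    using that assms left_range right_range by blast+
  have far: "i \<in> {1..n}" if "i \<in> far_from S" for i
    using that by (simp add: far_from_def)
  have "(\<Prod>s\<in>S. minor (left s) (right s)) \<in> cut_prime T \<longleftrightarrow>
      (\<exists>s\<in>S. left s \<in> T \<or> right s \<in> T \<or> comp_label T (left s) = comp_label T (right s))"
    using range finite_subset[OF assms]
    by (simp add: prod_mem_cut_prime_iff carrier_minor minor_mem_cut_prime_iff)
  moreover have "(\<Prod>i\<in>far_from S. indet (X i)) \<in> cut_prime T \<longleftrightarrow> (\<exists>i\<in>far_from S. i \<in> T)"
    using far
    by (simp add: prod_mem_cut_prime_iff finite_far_from carrier_indet indet_X_mem_cut_prime_iff)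
  ultimately show ?thesis
    unfolding cut_witness_def
    by (auto simp: mult_mem_cut_prime_iff[OF cut_witness_factors_carrier[OF assms]])
qed

text \<open>
  Every vertex of \<open>T - S\<close> is adjacent to \<open>S\<close>, so deleting it does not disconnect its component:
  it can take over the label of its other neighbour.
\<close>

lemma comp_label_eq_if_far_from_disjoint:
  assumes "S \<subseteq> T" "far_from S \<inter> T = {}" "u \<notin> T" "v \<notin> T" "comp_label S u = comp_label S v"
  shows "comp_label T u = comp_label T v"
proof -
  define h where "h i = (if i \<notin> T then comp_label T i
    else if right i \<notin> T then comp_label T (right i)
    else if left i \<notin> T then comp_label T (left i) else 0)" for i
  have "locally_constant S h"
  proof (rule locally_constant_cycleI)
    fix i assume i: "i \<in> {1..n}" "i \<notin> S" "right i \<notin> S"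
    have ri: "right i \<in> {1..n}" "left (right i) = i"
      by (fact right_range[OF i(1)], fact left_right[OF i(1)])
    have left: "left i \<in> T" if "i \<in> T"
      using that i assms(1,2) by (auto simp: far_from_def)
    have right: "right (right i) \<in> T" if "right i \<in> T"
      using that i ri assms(1,2) by (auto simp: far_from_def)
    show "h i = h (right i)"
    proof (cases "i \<in> T"; cases "right i \<in> T")
      assume "i \<notin> T" "right i \<notin> T"
      then show ?thesis using comp_label_right[OF i(1)] by (simp add: h_def)
    qed (use left right ri(2) in \<open>simp_all add: h_def\<close>)
  qed
  then have "h u = h v" using assms(5) by (rule locally_constantD)
  then show ?thesis using assms(3,4) by (simp add: h_def)
qed

lemma prime_colon_degree_cut_witness:
  assumes S: "S \<subseteq> {1..n}" "card S \<ge> 2" and indep: "\<And>s. s \<in> S \<Longrightarrow> right s \<notin> S"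
  shows "prime_colon_degree n J (2 * card S + card (far_from S))"
proof (rule prime_colon_degreeI)
  note notin = cut_witness_notin_cut_prime_iff[OF S(1)]
  show "cut_witness S \<in> carrier R"
    unfolding cut_witness_def by (intro carrier_mult cut_witness_factors_carrier[OF S(1)])
  show "cut_witness S \<notin> cut_prime S"
    unfolding notin
  proof (intro conjI ballI)
    show "far_from S \<inter> S = {}" by (auto simp: far_from_def)
    fix s assume s: "s \<in> S"
    then have range: "s \<in> {1..n}" using S(1) by blast
    show right: "right s \<notin> S" using indep s by blast
    show left: "left s \<notin> S" using indep[of "left s"] s right_left[OF range] by auto
    have "S \<noteq> {s}" using S(2) by auto
    then obtain r where "r \<in> S" "r \<noteq> s" using s by blast
    then show "comp_label S (left s) \<noteq> comp_label S (right s)"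
      using comp_label_left_neq_right[OF s, of r] S(1) range left right by blast
  qed
  show subset: "S \<subseteq> T" if "T \<subseteq> {1..n}" "cut_witness S \<notin> cut_prime T" for T
  proof
    fix s assume s: "s \<in> S"
    then have range: "s \<in> {1..n}" using S(1) by blast
    have sep: "left s \<notin> T" "right s \<notin> T" "comp_label T (left s) \<noteq> comp_label T (right s)"
      using that(2) s unfolding notin by blast+
    show "s \<in> T"
    proof (rule ccontr)
      assume "s \<notin> T"
      then show False using comp_label_left[OF range] comp_label_right[OF range] sep by simp
    qed
  qed
  show "comp_label T u = comp_label T v"
    if "T \<subseteq> {1..n}" "cut_witness S \<notin> cut_prime T" "u \<in> {1..n} - T" "v \<in> {1..n} - T"
      "comp_label S u = comp_label S v" for T u v
  proof (rule comp_label_eq_if_far_from_disjoint[OF subset[OF that(1,2)] _ _ _ that(5)])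
    show "far_from S \<inter> T = {}" using that(2) unfolding notin by blast
  qed (use that(3,4) in auto)
qed (fact S(1) homogeneous_cut_witness)+

definition every_third :: "nat set" where
  "every_third = {i \<in> {1..n}. i mod 3 = 2}"

lemma card_every_third: "card every_third = (n + 1) div 3"
proof -
  have "every_third = (\<lambda>j. 3 * j + 2) ` {..<(n + 1) div 3}"
  proof (intro equalityI subsetI)
    fix i assume "i \<in> every_third"
    then have "i = 3 * (i div 3) + 2" "i \<le> n"
      using mult_div_mod_eq[of 3 i] by (simp_all add: every_third_def)
    moreover from this have "i div 3 < (n + 1) div 3" by linarith
    ultimately show "i \<in> (\<lambda>j. 3 * j + 2) ` {..<(n + 1) div 3}" by blast
  next
    fix i assume "i \<in> (\<lambda>j. 3 * j + 2) ` {..<(n + 1) div 3}"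
    then obtain j where "i = 3 * j + 2" "j < (n + 1) div 3" by blast
    then have "i \<ge> 1" "i \<le> n" "i mod 3 = 2" by presburger+
    then show "i \<in> every_third" by (simp add: every_third_def)
  qed
  then show ?thesis by (simp add: card_image inj_on_def)
qed

lemma far_from_every_third_subset: "far_from every_third \<subseteq> (if n mod 3 = 1 then {n} else {})"
proof
  fix i assume i: "i \<in> far_from every_third"
  have "i \<ge> 1" "i mod 3 \<noteq> 2"
    using i by (auto simp: far_from_def every_third_def)
  moreover have "i mod 3 \<noteq> 1" if "i \<noteq> n"
  proof -
    have "(i + 1) mod 3 \<noteq> 2" using i that by (auto simp: far_from_def every_third_def right_def)
    then show ?thesis by presburger
  qed
  moreover have "i mod 3 \<noteq> 0" if "i \<noteq> 1"
  proof -
    have "(i - 1) mod 3 \<noteq> 2" using i that by (auto simp: far_from_def every_third_def left_def)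
    then show ?thesis using \<open>i \<ge> 1\<close> by (cases i) (auto simp: mod_Suc)
  qed
  ultimately have "i = n \<and> n mod 3 = 1" by (cases "i = 1"; cases "i = n"; simp; presburger)
  then show "i \<in> (if n mod 3 = 1 then {n} else {})" by simp
qed

lemma prime_colon_degree_upper_bound: "\<exists>d. prime_colon_degree n J d \<and> 3 * d \<le> 2 * n + 2"
proof (cases "n = 4")
  case True
  then show ?thesis using prime_colon_degree_connected by (intro exI[of _ "n - 2"]) simp
next
  case False
  let ?S = every_third
  have "prime_colon_degree n J (2 * card ?S + card (far_from ?S))"
  proof (rule prime_colon_degree_cut_witness)
    show "?S \<subseteq> {1..n}" by (auto simp: every_third_def)
    show "card ?S \<ge> 2" unfolding card_every_third using n_ge_4 False by presburger
    fix s assume "s \<in> ?S"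
    then have "s mod 3 = 2" by (simp add: every_third_def)
    then have "right s mod 3 \<noteq> 2" by (simp add: right_def mod_Suc)
    then show "right s \<notin> ?S" by (simp add: every_third_def)
  qed
  moreover have "card (far_from ?S) \<le> card (if n mod 3 = 1 then {n} else {})"
    by (rule card_mono[OF _ far_from_every_third_subset]) simp
  then have "card (far_from ?S) \<le> (if n mod 3 = 1 then 1 else 0)" by (simp split: if_splits)
  then have "3 * (2 * card ?S + card (far_from ?S)) \<le> 2 * n + 2"
    unfolding card_every_third by presburger
  ultimately show ?thesis by blast
qed

subsection \<open>The v-number\<close>

lemma v_number_bounds:
  shows "3 * v_number n J \<le> 2 * n + 2" and "2 * n \<le> 3 * v_number n J + 2"
proof -
  obtain d where d: "prime_colon_degree n J d" "3 * d \<le> 2 * n + 2"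
    using prime_colon_degree_upper_bound by blast
  have "v_number n J \<le> d" unfolding v_number_eq_Least using d(1) by (rule Least_le)
  then show "3 * v_number n J \<le> 2 * n + 2" using d(2) by linarith
  have "prime_colon_degree n J (v_number n J)"
    unfolding v_number_eq_Least using d(1) by (rule LeastI)
  then show "2 * n \<le> 3 * v_number n J + 2" by (rule prime_colon_degree_lower_bound)
qed

end

theorem theorem1:
  fixes n :: nat
  assumes "n \<ge> 4"
  shows "(n mod 3 = 0 \<longrightarrow>
            real (v_number n (binomial_edge_ideal n (cycle_edges n))) = 2 * real n / 3) \<and>
         (n mod 3 = 1 \<or> n mod 3 = 2 \<longrightarrow>
            int (v_number n (binomial_edge_ideal n (cycle_edges n))) = \<lceil>2 * real n / 3\<rceil> \<or>
            int (v_number n (binomial_edge_ideal n (cycle_edges n))) = \<lceil>2 * real n / 3\<rceil> - 1)"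
proof -
  interpret cycle n by standard (fact assms)
  let ?v = "v_number n J"
  note bounds = v_number_bounds
  have "real ?v = 2 * real n / 3" if "n mod 3 = 0"
  proof -
    have "3 * ?v = 2 * n" using bounds that by presburger
    then show ?thesis by linarith
  qed
  moreover have "int ?v = \<lceil>2 * real n / 3\<rceil> \<or> int ?v = \<lceil>2 * real n / 3\<rceil> - 1"
    using bounds ceiling_correct[of "2 * real n / 3"] by linarith
  ultimately show ?thesis by blast
qed

end
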